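(* Let $(\mathsf{X},\mathscr{X})$ be a measurable space and $P$ a Markov kernel on $\mathsf{X}\times\mathscr{X}$ satisfying: (i) $P$ is irreducible and aperiodic with unique invariant probability $\pi$; (ii) there exist a non-empty set $\mathsf{C}\in\mathscr{X}$ and reals $u>1$, $M>0$ such that $\sup_{x\in\mathsf{C}}\mathbb{E}_x[u^{\sigma_{\mathsf{C}}}]\leqslant M$, where $\sigma_{\mathsf{C}}=\inf\{n\geqslant 1: X_n\in\mathsf{C}\}$; (iii) there exist $r\in(0,1)$ and $L\geqslant 1$ such that $\mathrm{d}_{\mathrm{TV}}(\delta_xP^n,\pi)\leqslant Lr^n$ for all $x\in\mathsf{C}$ and all $n\geqslant 0$. Let $n\geqslant 1$, $c=(c_0,\ldots,c_{n-1})\in\mathbb{R}_+^n$ and let $f:\mathsf{X}^n\to\mathbb{R}$ be measurable with $|f(x)-f(y)|\leqslant\sum_{i=0}^{n-1}c_i\mathbf{1}_{\{x_i\neq y_i\}}$ for all $x=(x_0,\ldots,x_{n-1}),y=(y_0,\ldots,y_{n-1})\in\mathsf{X}^n$. Then for all $x\in\mathsf{C}$ and all $t>0$, \[ \mathbb{P}_x\big(f(X_0,\ldots,X_{n-1})-\mathbb{E}_x[f(X_0,\ldots,X_{n-1})]>t\big)\leqslant \exp\Big(-\frac{\beta t^2}{\|c\|^2}\Big), \] where $\|c\|^2=\sum_{i=0}^{n-1}c_i^2$ and \[ \beta=\frac{(1-\max(r,u^{-1/4}))^2}{16L}\Big(\frac{5}{\log u}+4ML\Big)^{-1}. \]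
   Context: $(X_k)_{k\geqslant 0}$ is the canonical process on $\mathsf{X}^{\mathbb{Z}_+}$; for a probability measure $\xi$, $\mathbb{P}_\xi$ is the law under which $(X_k)$ is a Markov chain with kernel $P$ and initial distribution $\xi$, $\mathbb{E}_\xi$ its expectation, and $\mathbb{P}_x=\mathbb{P}_{\delta_x}$, $\mathbb{E}_x=\mathbb{E}_{\delta_x}$ with $\delta_x$ the Dirac mass at $x$. $\mathrm{d}_{\mathrm{TV}}(\mu,\nu)=\sup_{A\in\mathscr{X}}|\mu(A)-\nu(A)|$ is the total variation distance. *)

theory Defs
  imports "HOL-Probability.Probability"
begin

(* Markov kernel P on a measurable space M: P <in> M <rightarrow><^sub>M prob_algebra M. *)

fun kpow :: "'a measure \<Rightarrow> ('a \<Rightarrow> 'a measure) \<Rightarrow> nat \<Rightarrow> 'a \<Rightarrow> 'a measure" where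
  "kpow M P 0 x = return M x"
| "kpow M P (Suc n) x = bind (kpow M P n x) P"

fun chain_law :: "'a measure \<Rightarrow> ('a \<Rightarrow> 'a measure) \<Rightarrow> 'a measure \<Rightarrow> nat \<Rightarrow> (nat \<Rightarrow> 'a) measure" where
  "chain_law M P \<xi> 0 = return (PiM {} (\<lambda>_. M)) (\<lambda>_. undefined)"
| "chain_law M P \<xi> (Suc 0) = distr \<xi> (PiM {..<Suc 0} (\<lambda>_. M)) (\<lambda>y. \<lambda>i\<in>{..<Suc 0}. y)"
| "chain_law M P \<xi> (Suc (Suc n)) =
     bind (chain_law M P \<xi> (Suc n))
       (\<lambda>\<omega>. distr (P (\<omega> n)) (PiM {..<Suc (Suc n)} (\<lambda>_. M))
               (\<lambda>y. \<lambda>i\<in>{..<Suc (Suc n)}. if i = Suc n then y else \<omega> i))"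

definition hit_prob :: "'a measure \<Rightarrow> ('a \<Rightarrow> 'a measure) \<Rightarrow> 'a \<Rightarrow> 'a set \<Rightarrow> nat \<Rightarrow> ennreal" where
  "hit_prob M P x C k = emeasure (chain_law M P (return M x) (Suc k))
      {\<omega> \<in> space (PiM {..<Suc k} (\<lambda>_. M)). (\<forall>i\<in>{1..<k}. \<omega> i \<notin> C) \<and> \<omega> k \<in> C}"

(* E_x[u^{<sigma>_C}] with the convention u^<infinity> = <infinity> (u > 1):
  sum over finite values of <sigma>_C plus <infinity> times P_x(<sigma>_C = <infinity>). *)
definition exp_hit :: "'a measure \<Rightarrow> ('a \<Rightarrow> 'a measure) \<Rightarrow> 'a \<Rightarrow> 'a set \<Rightarrow> real \<Rightarrow> ennreal" where
  "exp_hit M P x C u =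
     (\<Sum>k. ennreal (u ^ Suc k) * hit_prob M P x C (Suc k))
     + \<top> * (1 - (\<Sum>k. hit_prob M P x C (Suc k)))"

definition dTV :: "'a measure \<Rightarrow> 'a measure \<Rightarrow> real" where
  "dTV \<mu> \<nu> = (SUP A\<in>sets \<mu>. \<bar>measure \<mu> A - measure \<nu> A\<bar>)"

definition invariant_prob :: "'a measure \<Rightarrow> ('a \<Rightarrow> 'a measure) \<Rightarrow> 'a measure \<Rightarrow> bool" where
  "invariant_prob M P \<pi> \<longleftrightarrow> prob_space \<pi> \<and> sets \<pi> = sets M \<and> bind \<pi> P = \<pi>"

(* Accessible set (Douc-Moulines-Priouret-Soulier): P_x(<sigma>_A < <infinity>) > 0 for all x,
  i.e. P^n(x,A) > 0 for some n <ge> 1. *)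
definition accessible :: "'a measure \<Rightarrow> ('a \<Rightarrow> 'a measure) \<Rightarrow> 'a set \<Rightarrow> bool" where
  "accessible M P A \<longleftrightarrow> A \<in> sets M \<and>
     (\<forall>x\<in>space M. \<exists>n\<ge>1. emeasure (kpow M P n x) A > 0)"

definition small_set :: "'a measure \<Rightarrow> ('a \<Rightarrow> 'a measure) \<Rightarrow> 'a set \<Rightarrow> nat \<Rightarrow> 'a measure \<Rightarrow> bool" where
  "small_set M P C m \<mu> \<longleftrightarrow> C \<in> sets M \<and> m \<ge> 1 \<and> sets \<mu> = sets M \<and>
     emeasure \<mu> (space M) > 0 \<and>
     (\<forall>x\<in>C. \<forall>A\<in>sets M. emeasure \<mu> A \<le> emeasure (kpow M P m x) A)"

definition irreducible :: "'a measure \<Rightarrow> ('a \<Rightarrow> 'a measure) \<Rightarrow> bool" where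
  "irreducible M P \<longleftrightarrow> (\<exists>C. accessible M P C \<and> (\<exists>m \<mu>. small_set M P C m \<mu>))"

definition small_times :: "'a measure \<Rightarrow> ('a \<Rightarrow> 'a measure) \<Rightarrow> 'a set \<Rightarrow> 'a measure \<Rightarrow> nat set" where
  "small_times M P C \<nu> = {n. n \<ge> 1 \<and> (\<exists>\<epsilon>>0. \<forall>x\<in>C. \<forall>A\<in>sets M.
       ennreal \<epsilon> * emeasure \<nu> A \<le> emeasure (kpow M P n x) A)}"

(* Aperiodic: irreducible with period 1, the period being gcd E_C for an accessible
  (m, <epsilon><nu>)-small set C with <nu>(C) > 0 (the value is independent of C). *)
definition aperiodic :: "'a measure \<Rightarrow> ('a \<Rightarrow> 'a measure) \<Rightarrow> bool" where
  "aperiodic M P \<longleftrightarrow> irreducible M P \<and>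
     (\<exists>C \<nu>. accessible M P C \<and> prob_space \<nu> \<and> sets \<nu> = sets M \<and> emeasure \<nu> C > 0 \<and>
        small_times M P C \<nu> \<noteq> {} \<and> Gcd (small_times M P C \<nu>) = 1)"

end

(*
  Martingale differences are taken along the successive returns to C instead of along time. Let
  g_k be the conditional expectation of f given X_0, ..., X_k. If X_k and X_j lie in C, the fast
  mixing from C gives |g_j - g_k| <= d, where d is the sum of the c_i over k < i <= j plus
  4 L times the sum of c_i r^(i - j) over i > j. With e^x <= 1 + x + x^2 e^|x| / 2 and
  E[g_j - g_k] = 0 at the first return time j after k, one excursion multiplies the exponential
  moment by at most 1 + E[d^2 e^d] / 2. When all c_i are small compared with log u, Cauchy-Schwarz
  bounds d^2 e^d by u^(j - k) times a geometrically weighted sum of the c_i^2, and the moment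
  hypothesis on the return time concludes by backward induction on k. Coordinates with a large c_i
  are frozen beforehand; this costs 2 c_i, which is dominated by c_i^2 precisely because c_i is
  large. The tail bound follows by Chernoff's method.
*)
theory Submission
  imports Defs
begin

section \<open>Bounded measurable functions and total variation\<close>

text \<open>The usual differences from one time to the next are out of reach: mixing is quantified
  only from points of \<open>C\<close>, and elsewhere nothing controls how fast the future forgets
  the present state. Within an excursion each coordinate can only be charged its full
  \<open>c i\<close>, so \<open>d\<close> grows with the length \<open>j - k\<close>, and the
  geometric moment of that length has to pay twice: one half of \<open>u ^ (j - k)\<close> for
  \<open>exp d\<close>, the other half for the growth of \<open>d\<^sup>2\<close>. The second
  payment is the origin of \<open>u powr (-1/4)\<close> in \<gamma>.

  Smallness of the coefficients cannot be assumed or obtained by rescaling, since Chernoff's method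
  needs the exponential moments of \<open>s * f\<close> for every \<open>s\<close>. The cut between
  small and large is therefore applied to \<open>s * c i\<close> and moves with \<open>s\<close>. In
  \<beta>, the term 5 / log u is the price of freezing and 4 M L that of the excursions.

  Conditional expectations are explicit iterated integrals, defined at every path. All estimates
  hold pointwise and no null sets appear.\<close>

definition bounded_measurable :: "'a measure \<Rightarrow> ('a \<Rightarrow> real) \<Rightarrow> bool" where
  "bounded_measurable K h \<longleftrightarrow> h \<in> borel_measurable K \<and> (\<exists>B. \<forall>x\<in>space K. \<bar>h x\<bar> \<le> B)"

lemma bounded_measurableI:
  "h \<in> borel_measurable K \<Longrightarrow> (\<And>x. x \<in> space K \<Longrightarrow> \<bar>h x\<bar> \<le> B) \<Longrightarrow> bounded_measurable K h"
  by (auto simp: bounded_measurable_def)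

lemma bounded_measurable_const: "bounded_measurable K (\<lambda>_. a)"
  by (auto simp: bounded_measurable_def)

lemma bounded_measurable_add:
  assumes "bounded_measurable K h" "bounded_measurable K g"
  shows "bounded_measurable K (\<lambda>x. h x + g x)"
proof -
  obtain A B where "\<forall>x\<in>space K. \<bar>h x\<bar> \<le> A" "\<forall>x\<in>space K. \<bar>g x\<bar> \<le> B"
    using assms by (auto simp: bounded_measurable_def)
  then show ?thesis
    using assms by (intro bounded_measurableI[where B="A + B"])
      (force simp: bounded_measurable_def intro: order.trans[OF abs_triangle_ineq] add_mono)+
qed

lemma bounded_measurable_mult:
  assumes "bounded_measurable K h" "bounded_measurable K g"
  shows "bounded_measurable K (\<lambda>x. h x * g x)"
proof -
  obtain A B where AB: "\<forall>x\<in>space K. \<bar>h x\<bar> \<le> A" "\<forall>x\<in>space K. \<bar>g x\<bar> \<le> B"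
    using assms by (auto simp: bounded_measurable_def)
  show ?thesis
  proof (rule bounded_measurableI[where B="A * B"])
    fix x assume x: "x \<in> space K"
    then have "0 \<le> A" using AB(1) by force
    with x AB show "\<bar>h x * g x\<bar> \<le> A * B"
      by (auto simp: abs_mult intro!: mult_mono)
  qed (use assms in \<open>auto simp: bounded_measurable_def\<close>)
qed

lemma bounded_measurable_diff:
  assumes "bounded_measurable K h" "bounded_measurable K g"
  shows "bounded_measurable K (\<lambda>x. h x - g x)"
  using bounded_measurable_add[OF assms(1) bounded_measurable_mult[OF bounded_measurable_const[of K "-1"] assms(2)]]
  by simp

lemma bounded_measurable_sum:
  "(\<And>i. i \<in> I \<Longrightarrow> bounded_measurable K (h i)) \<Longrightarrow> bounded_measurable K (\<lambda>x. \<Sum>i\<in>I. h i x)"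
  by (induction I rule: infinite_finite_induct)
    (auto intro!: bounded_measurable_const bounded_measurable_add)

lemma bounded_measurable_exp:
  assumes "bounded_measurable K h"
  shows "bounded_measurable K (\<lambda>x. exp (h x))"
proof -
  obtain B where B: "\<forall>x\<in>space K. \<bar>h x\<bar> \<le> B"
    using assms by (auto simp: bounded_measurable_def)
  then show ?thesis
    using assms by (intro bounded_measurableI[where B="exp B"]) (auto simp: bounded_measurable_def abs_le_iff)
qed

lemma bounded_measurable_compose:
  assumes "bounded_measurable K h" "g \<in> M \<rightarrow>\<^sub>M K"
  shows "bounded_measurable M (\<lambda>x. h (g x))"
  using assms measurable_space[OF assms(2)] unfolding bounded_measurable_def by auto

text \<open>The reason for working in this class: it is closed under all operations used below, and
  its members are integrable for every kernel value at once.\<close>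

lemma bounded_measurable_integrable:
  assumes "bounded_measurable K h" "sets Q = sets K" "finite_measure Q"
  shows "integrable Q h"
proof -
  interpret finite_measure Q by fact
  obtain B where "\<forall>x\<in>space K. \<bar>h x\<bar> \<le> B" using assms by (auto simp: bounded_measurable_def)
  then show ?thesis
    using assms(1) sets_eq_imp_space_eq[OF assms(2)]
    by (intro integrable_const_bound[where B=B] AE_I2)
       (auto simp: bounded_measurable_def cong: measurable_cong_sets[OF assms(2) refl])
qed

lemma bounded_measurable_If_one:
  assumes "C \<in> sets K" "bounded_measurable K h"
  shows "bounded_measurable K (\<lambda>x. if x \<in> C then 1 else h x)"
proof -
  obtain B where B: "\<forall>x\<in>space K. \<bar>h x\<bar> \<le> B"
    using assms by (auto simp: bounded_measurable_def)
  show ?thesis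
  proof (rule bounded_measurableI[where B="max 1 B"])
    show "(\<lambda>x. if x \<in> C then 1 else h x) \<in> borel_measurable K"
      using assms by (intro measurable_If_set) (auto simp: bounded_measurable_def)
  qed (use B in auto)
qed

section \<open>Integration against Markov kernels\<close>

lemma kernelD:
  assumes "Q \<in> M \<rightarrow>\<^sub>M prob_algebra K" "x \<in> space M"
  shows "prob_space (Q x)" "sets (Q x) = sets K" "space (Q x) = space K"
proof -
  have "Q x \<in> space (prob_algebra K)" using measurable_space[OF assms] .
  then show "prob_space (Q x)" "sets (Q x) = sets K" "space (Q x) = space K"
    by (auto simp: space_prob_algebra dest: sets_eq_imp_space_eq)
qed

lemma kernel_integrable:
  assumes "Q \<in> M \<rightarrow>\<^sub>M prob_algebra K" "x \<in> space M" "bounded_measurable K h"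
  shows "integrable (Q x) h"
  using kernelD[OF assms(1,2)] assms(3)
  by (intro bounded_measurable_integrable) (auto simp: prob_space_def)

lemma abs_integral_le:
  assumes "prob_space Q" "bounded_measurable K h" "sets Q = sets K"
    and "\<And>y. y \<in> space K \<Longrightarrow> \<bar>h y\<bar> \<le> B"
  shows "\<bar>integral\<^sup>L Q h\<bar> \<le> B"
proof -
  interpret prob_space Q by fact
  have i: "integrable Q h"
    by (rule bounded_measurable_integrable[OF assms(2,3)]) (unfold_locales)
  have s: "space Q = space K" using assms(3) by (rule sets_eq_imp_space_eq)
  have "\<bar>integral\<^sup>L Q h\<bar> \<le> integral\<^sup>L Q (\<lambda>x. \<bar>h x\<bar>)" by (rule integral_abs_bound)
  also have "\<dots> \<le> integral\<^sup>L Q (\<lambda>x. B)"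
    using i assms(4) s by (intro integral_mono) auto
  finally show ?thesis by (simp add: prob_space)
qed

lemma bounded_measurable_kernel_integral:
  assumes Q: "Q \<in> M \<rightarrow>\<^sub>M prob_algebra K" and h: "bounded_measurable K h"
  shows "bounded_measurable M (\<lambda>x. integral\<^sup>L (Q x) h)"
proof -
  obtain B where B: "\<And>x. x \<in> space K \<Longrightarrow> \<bar>h x\<bar> \<le> B"
    using h by (auto simp: bounded_measurable_def)
  show ?thesis
  proof (rule bounded_measurableI[where B=B])
    have [measurable]: "h \<in> borel_measurable K" using h by (auto simp: bounded_measurable_def)
    have [measurable]: "Q \<in> M \<rightarrow>\<^sub>M subprob_algebra K" by (rule measurable_prob_algebraD[OF Q])
    show "(\<lambda>x. integral\<^sup>L (Q x) h) \<in> borel_measurable M"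
      by (rule measurable_compose[OF _ integral_measurable_subprob_algebra[where N=K]]) simp_all
  qed (use kernelD[OF Q] h B in \<open>auto intro!: abs_integral_le\<close>)
qed

section \<open>Total variation distance and integrals of bounded functions\<close>

lemma dTV_ge:
  assumes "prob_space \<mu>" "prob_space \<nu>" "A \<in> sets \<mu>"
  shows "\<bar>measure \<mu> A - measure \<nu> A\<bar> \<le> dTV \<mu> \<nu>"
  unfolding dTV_def
proof (rule cSUP_upper[OF assms(3)])
  show "bdd_above ((\<lambda>A. \<bar>measure \<mu> A - measure \<nu> A\<bar>) ` sets \<mu>)"
  proof (rule bdd_aboveI2[where M=1])
    fix A
    have "measure \<mu> A \<le> 1" "measure \<nu> A \<le> 1" "measure \<mu> A \<ge> 0" "measure \<nu> A \<ge> 0"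
      using assms by (auto simp: prob_space.prob_le_1)
    then show "\<bar>measure \<mu> A - measure \<nu> A\<bar> \<le> 1" by linarith
  qed
qed

text \<open>On a Hahn set \<open>Y\<close> the nonnegative function \<open>B - h\<close> has the
  larger integral under \<mu>, and off \<open>Y\<close> the function \<open>B + h\<close> has the
  larger one under \<nu>. Up to these two favourable terms \<open>h\<close> is \<open>2 * B\<close>
  times the indicator of \<open>Y\<close>, minus \<open>B\<close>. The factor 2 reflects that
  \<open>dTV\<close> is a supremum over events.\<close>

lemma integral_diff_le_dTV:
  assumes pm: "prob_space \<mu>" and pn: "prob_space \<nu>" and sm: "sets \<mu> = sets M" and sn: "sets \<nu> = sets M"
    and h: "bounded_measurable M h" and hB: "\<And>y. y \<in> space M \<Longrightarrow> \<bar>h y\<bar> \<le> B"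
  shows "integral\<^sup>L \<mu> h - integral\<^sup>L \<nu> h \<le> 2 * B * dTV \<mu> \<nu>"
proof -
  interpret m: prob_space \<mu> by fact
  interpret n: prob_space \<nu> by fact
  have spm: "space \<mu> = space M" and spn: "space \<nu> = space M" using sm sn by (auto dest: sets_eq_imp_space_eq)
  have "\<exists>Y\<in>sets \<mu>. (\<forall>X\<in>sets \<mu>. X \<subseteq> Y \<longrightarrow> emeasure \<nu> X \<le> emeasure \<mu> X) \<and> (\<forall>X\<in>sets \<mu>. X \<inter> Y = {} \<longrightarrow> emeasure \<mu> X \<le> emeasure \<nu> X)"
    by (rule finite_unsigned_Hahn_decomposition) (use sm sn in \<open>auto simp: m.finite_measure_axioms n.finite_measure_axioms\<close>)
  then obtain Y where Y: "Y \<in> sets M"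
    and Y1: "\<And>X. X \<in> sets M \<Longrightarrow> X \<subseteq> Y \<Longrightarrow> emeasure \<nu> X \<le> emeasure \<mu> X"
    and Y2: "\<And>X. X \<in> sets M \<Longrightarrow> X \<inter> Y = {} \<Longrightarrow> emeasure \<mu> X \<le> emeasure \<nu> X"
    using sm by auto
  have hm[measurable]: "h \<in> borel_measurable M" using h by (auto simp: bounded_measurable_def)
  \<comment> \<open>Restricting both measures to \<open>Z\<close> by a density turns the comparison
    on subsets of \<open>Z\<close> into an order between measures, in which the integral is
    monotone.\<close>
  have mono: "(\<integral>\<^sup>+x. g x * indicator Z x \<partial>q1) \<le> (\<integral>\<^sup>+x. g x * indicator Z x \<partial>q2)"
    if "sets q1 = sets M" "sets q2 = sets M" "g \<in> borel_measurable M" "Z \<in> sets M"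
      "\<And>X. X \<in> sets M \<Longrightarrow> X \<subseteq> Z \<Longrightarrow> emeasure q1 X \<le> emeasure q2 X" for g :: "'a \<Rightarrow> ennreal" and Z q1 q2
  proof -
    have le: "density q1 (indicator Z) \<le> density q2 (indicator Z)"
    proof (rule le_measure[THEN iffD2], goal_cases)
      case 2
      show ?case
      proof
        fix A assume "A \<in> sets (density q1 (indicator Z))"
        then have A: "A \<in> sets M" using that by simp
        then show "emeasure (density q1 (indicator Z)) A \<le> emeasure (density q2 (indicator Z)) A"
          using that by (simp add: emeasure_density measurable_cong_sets[OF that(1) refl] measurable_cong_sets[OF that(2) refl]
            flip: indicator_inter_arith)
      qed
    qed (use that in auto)
    have "(\<integral>\<^sup>+x. g x \<partial>density q1 (indicator Z)) \<le> (\<integral>\<^sup>+x. g x \<partial>density q2 (indicator Z))"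
      using that by (intro nn_integral_mono_measure le) auto
    then show ?thesis
      using that by (simp add: nn_integral_density measurable_cong_sets[OF that(1) refl] measurable_cong_sets[OF that(2) refl] mult.commute)
  qed
  have rmono: "(\<integral>x. g x * indicator Z x \<partial>q1) \<le> (\<integral>x. g x * indicator Z x \<partial>q2)"
    if "prob_space q1" "prob_space q2" "sets q1 = sets M" "sets q2 = sets M" "bounded_measurable M g" "Z \<in> sets M"
      "\<And>x. x \<in> space M \<Longrightarrow> 0 \<le> g x"
      "\<And>X. X \<in> sets M \<Longrightarrow> X \<subseteq> Z \<Longrightarrow> emeasure q1 X \<le> emeasure q2 X" for g :: "'a \<Rightarrow> real" and Z q1 q2
  proof -
    interpret q1: prob_space q1 by fact
    interpret q2: prob_space q2 by fact
    have sp: "space q1 = space M" "space q2 = space M" using that by (auto dest: sets_eq_imp_space_eq)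
    have gm[measurable]: "g \<in> borel_measurable M" using that by (auto simp: bounded_measurable_def)
    have bm: "bounded_measurable M (\<lambda>x. g x * indicator Z x)"
      by (intro bounded_measurable_mult that bounded_measurableI[where B=1]) (use that in \<open>auto simp: indicator_def\<close>)
    have e: "ennreal (\<integral>x. g x * indicator Z x \<partial>q) = (\<integral>\<^sup>+x. ennreal (g x) * indicator Z x \<partial>q)"
      if q: "prob_space q" "sets q = sets M" for q
    proof -
      have "space q = space M" using q by (auto dest: sets_eq_imp_space_eq)
      then show ?thesis
        using bounded_measurable_integrable[OF bm q(2)] q \<open>\<And>x. x \<in> space M \<Longrightarrow> 0 \<le> g x\<close>
        by (subst nn_integral_eq_integral[symmetric])
           (auto simp: prob_space_def intro!: AE_I2 nn_integral_cong split: split_indicator)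
    qed
    have "ennreal (\<integral>x. g x * indicator Z x \<partial>q1) \<le> ennreal (\<integral>x. g x * indicator Z x \<partial>q2)"
      using that by (subst (1 2) e) (auto intro!: mono)
    moreover have "0 \<le> (\<integral>x. g x * indicator Z x \<partial>q2)"
      using that sp by (intro integral_nonneg_AE AE_I2) auto
    ultimately show ?thesis by simp
  qed
  let ?Z = "space M - Y"
  have Z: "?Z \<in> sets M" using Y by auto
  have bi: "bounded_measurable M (indicator X)" if "X \<in> sets M" for X
    using that by (intro bounded_measurableI[where B=1]) (auto simp: indicator_def)
  note bms = bounded_measurable_mult bounded_measurable_add bounded_measurable_diff bounded_measurable_const h bi Y Z
  have 1: "(\<integral>x. (B - h x) * indicator Y x \<partial>\<nu>) \<le> (\<integral>x. (B - h x) * indicator Y x \<partial>\<mu>)"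
    by (rule rmono) (use pm pn sm sn Y Y1 hB in \<open>auto intro!: bms simp: abs_le_iff\<close>)
  have 2: "(\<integral>x. (B + h x) * indicator ?Z x \<partial>\<mu>) \<le> (\<integral>x. (B + h x) * indicator ?Z x \<partial>\<nu>)"
  proof (rule rmono)
    show "emeasure \<mu> X \<le> emeasure \<nu> X" if "X \<in> sets M" "X \<subseteq> ?Z" for X
      using that by (intro Y2) auto
    show "0 \<le> B + h x" if "x \<in> space M" for x using hB[OF that] by linarith
  qed (use pm pn sm sn in \<open>auto intro!: bms\<close>)
  \<comment> \<open>Pointwise, \<open>h\<close> is \<open>2 * B - B - (B - h)\<close> on
    \<open>Y\<close> and \<open>- B + (B + h)\<close> off \<open>Y\<close>.\<close>
  have split: "integral\<^sup>L q h = 2 * B * measure q Y - B - (\<integral>x. (B - h x) * indicator Y x \<partial>q) + (\<integral>x. (B + h x) * indicator ?Z x \<partial>q)"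
    if q: "prob_space q" "sets q = sets M" for q
  proof -
    interpret q: prob_space q by fact
    have sp: "space q = space M" using q by (auto dest: sets_eq_imp_space_eq)
    have ig: "integrable q g" if "bounded_measurable M g" for g
      using bounded_measurable_integrable[OF that q(2) q.finite_measure_axioms] .
    have "(\<integral>x. (B + h x) * indicator ?Z x \<partial>q) - (\<integral>x. (B - h x) * indicator Y x \<partial>q)
      = (\<integral>x. (B + h x) * indicator ?Z x - (B - h x) * indicator Y x \<partial>q)"
      by (subst Bochner_Integration.integral_diff) (auto intro!: ig bms)
    also have "\<dots> = (\<integral>x. h x + B - 2 * B * indicator Y x \<partial>q)"
      by (intro Bochner_Integration.integral_cong refl) (auto simp: sp split: split_indicator)
    also have "\<dots> = (\<integral>x. h x \<partial>q) + B - 2 * B * measure q Y"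
      using Y q(2)
      by (subst Bochner_Integration.integral_diff, (auto intro!: ig bms)[2],
          subst Bochner_Integration.integral_add, (auto intro!: ig bms)[2]) (simp add: q.prob_space)
    finally show ?thesis by linarith
  qed
  have "integral\<^sup>L \<mu> h - integral\<^sup>L \<nu> h \<le> 2 * B * (measure \<mu> Y - measure \<nu> Y)"
    using 1 2 by (simp only: split[OF pm sm] split[OF pn sn]) (simp add: algebra_simps)
  also have "\<dots> \<le> 2 * B * dTV \<mu> \<nu>"
  proof (rule mult_left_mono)
    show "measure \<mu> Y - measure \<nu> Y \<le> dTV \<mu> \<nu>"
      using dTV_ge[OF pm pn, of Y] Y sm by auto
    obtain y where "y \<in> space M" using m.not_empty spm by auto
    then show "0 \<le> 2 * B" using hB[of y] by auto
  qed
  finally show ?thesis .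
qed

lemma integral_dist_le_dTV:
  assumes "prob_space \<mu>" "prob_space \<nu>" "sets \<mu> = sets M" "sets \<nu> = sets M"
    and "bounded_measurable M h" and "\<And>y. y \<in> space M \<Longrightarrow> \<bar>h y\<bar> \<le> B"
  shows "\<bar>integral\<^sup>L \<mu> h - integral\<^sup>L \<nu> h\<bar> \<le> 2 * B * dTV \<mu> \<nu>"
proof -
  have "bounded_measurable M (\<lambda>y. - h y)"
    using bounded_measurable_diff[OF bounded_measurable_const[of M 0] assms(5)] by simp
  then have "- integral\<^sup>L \<mu> h + integral\<^sup>L \<nu> h \<le> 2 * B * dTV \<mu> \<nu>"
    using integral_diff_le_dTV[OF assms(1-4), of "\<lambda>y. - h y" B] assms(6) by simp
  with integral_diff_le_dTV[OF assms] show ?thesis by linarith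
qed

section \<open>Conditional expectations along the chain\<close>

lemma measurable_fun_upd_PiM_UNIV [measurable]:
  "(\<lambda>(w, y). w(k := y)) \<in> PiM UNIV (\<lambda>_. M) \<Otimes>\<^sub>M M \<rightarrow>\<^sub>M PiM UNIV (\<lambda>_. M)"
  unfolding case_prod_beta
  by (rule measurable_fun_upd[where J=UNIV]) auto

text \<open>A pointwise substitute for measurability with respect to a block of coordinates: it
  allows the others to be overwritten at any given path.\<close>

definition depends_on :: "'a measure \<Rightarrow> nat \<Rightarrow> nat \<Rightarrow> ((nat \<Rightarrow> 'a) \<Rightarrow> real) \<Rightarrow> bool" where
  "depends_on M p q h \<longleftrightarrow> (\<forall>w\<in>space (PiM UNIV (\<lambda>_. M)). \<forall>v\<in>space (PiM UNIV (\<lambda>_. M)).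
     (\<forall>i\<in>{p..<q}. w i = v i) \<longrightarrow> h w = h v)"

lemma depends_onD:
  "depends_on M p q h \<Longrightarrow> w \<in> space (PiM UNIV (\<lambda>_. M)) \<Longrightarrow> v \<in> space (PiM UNIV (\<lambda>_. M)) \<Longrightarrow>
    (\<And>i. p \<le> i \<Longrightarrow> i < q \<Longrightarrow> w i = v i) \<Longrightarrow> h w = h v"
  unfolding depends_on_def by (meson atLeastLessThan_iff)

locale markov_kernel =
  fixes M :: "'a measure" and P :: "'a \<Rightarrow> 'a measure"
  assumes kernel: "P \<in> M \<rightarrow>\<^sub>M prob_algebra M"
begin

abbreviation paths :: "(nat \<Rightarrow> 'a) measure" where
  "paths \<equiv> PiM UNIV (\<lambda>_. M)"

text \<open>One transition on the space of infinite paths. Since the space does not change with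
  time, conditional expectations at different times compose directly.\<close>

definition resample :: "nat \<Rightarrow> (nat \<Rightarrow> 'a) \<Rightarrow> (nat \<Rightarrow> 'a) measure" where
  "resample k w = distr (P (w k)) paths (\<lambda>y. w(Suc k := y))"

text \<open>\<open>cexp k m h w\<close> is the conditional expectation of \<open>h\<close> given
  \<open>w\<^sub>0, \<dots>, w\<^sub>k\<close>, obtained by integrating out the coordinates
  \<open>k + 1, \<dots>, k + m\<close>; later coordinates are left as they are in \<open>w\<close>.\<close>

primrec cexp :: "nat \<Rightarrow> nat \<Rightarrow> ((nat \<Rightarrow> 'a) \<Rightarrow> real) \<Rightarrow> (nat \<Rightarrow> 'a) \<Rightarrow> real" where
  "cexp k 0 h = h"
| "cexp k (Suc m) h = cexp k m (\<lambda>w. integral\<^sup>L (resample (k + m) w) h)"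

lemma in_pathsD: "w \<in> space paths \<Longrightarrow> w i \<in> space M"
  by (auto simp: space_PiM)

lemma fun_upd_in_paths: "w \<in> space paths \<Longrightarrow> y \<in> space M \<Longrightarrow> w(k := y) \<in> space paths"
  by (auto simp: space_PiM)

lemma resample_kernel: "resample k \<in> paths \<rightarrow>\<^sub>M prob_algebra paths"
proof -
  have "(\<lambda>w. P (w k)) \<in> paths \<rightarrow>\<^sub>M prob_algebra M"
    by (rule measurable_compose[OF _ kernel]) simp
  then show ?thesis
    unfolding resample_def by (rule measurable_distr_prob_space2) simp
qed

lemma integral_resample:
  fixes h :: "(nat \<Rightarrow> 'a) \<Rightarrow> real"
  assumes "w \<in> space paths" "h \<in> borel_measurable paths"
  shows "integral\<^sup>L (resample k w) h = (\<integral>y. h (w(Suc k := y)) \<partial>P (w k))"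
proof -
  note s = kernelD(2)[OF kernel in_pathsD[OF assms(1)]]
  have "(\<lambda>y. w(Suc k := y)) \<in> M \<rightarrow>\<^sub>M paths"
    using measurable_compose[OF measurable_Pair1' measurable_fun_upd_PiM_UNIV, OF assms(1)] by simp
  then show ?thesis
    unfolding resample_def using assms(2)
    by (subst integral_distr) (auto simp: measurable_cong_sets[OF s refl])
qed

lemma bounded_measurable_upd:
  assumes "w \<in> space paths" "bounded_measurable paths h"
  shows "bounded_measurable M (\<lambda>y. h (w(k := y)))"
proof (rule bounded_measurable_compose[OF assms(2)])
  show "(\<lambda>y. w(k := y)) \<in> M \<rightarrow>\<^sub>M paths"
    using measurable_compose[OF measurable_Pair1' measurable_fun_upd_PiM_UNIV, OF assms(1)] by simp
qed

text \<open>Tower property, which the recursion yields as an equality of functions.\<close>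

lemma cexp_add: "cexp k (a + b) h = cexp k a (cexp (k + a) b h)"
  by (induction b arbitrary: h) (simp_all add: add.assoc)

lemma bounded_measurable_resample:
  "bounded_measurable paths h \<Longrightarrow> bounded_measurable paths (\<lambda>w. integral\<^sup>L (resample k w) h)"
  by (rule bounded_measurable_kernel_integral[OF resample_kernel])

lemma bounded_measurable_cexp:
  "bounded_measurable paths h \<Longrightarrow> bounded_measurable paths (cexp k m h)"
  by (induction m arbitrary: h) (simp_all add: bounded_measurable_resample)

lemma cexp_cong:
  "(\<And>w. w \<in> space paths \<Longrightarrow> h w = g w) \<Longrightarrow> w \<in> space paths \<Longrightarrow> cexp k m h w = cexp k m g w"
proof (induction m arbitrary: h g)
  case (Suc m)
  have "integral\<^sup>L (resample (k + m) v) h = integral\<^sup>L (resample (k + m) v) g" if "v \<in> space paths" for v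
    using kernelD(3)[OF resample_kernel that] Suc.prems(1) by (intro Bochner_Integration.integral_cong) auto
  then show ?case using Suc.prems(2) by (simp, intro Suc.IH) simp_all
qed simp

text \<open>The defining recursion removes the last coordinate; backward induction in time needs the
  first one removed instead. The tower property exchanges the two.\<close>

lemma cexp_Suc:
  assumes "w \<in> space paths" "bounded_measurable paths h"
  shows "cexp k (Suc m) h w = (\<integral>y. cexp (Suc k) m h (w(Suc k := y)) \<partial>P (w k))"
proof -
  have "cexp k (Suc m) h w = integral\<^sup>L (resample k w) (cexp (Suc k) m h)"
    using cexp_add[of k 1 m h] by simp
  then show ?thesis
    using bounded_measurable_cexp[OF assms(2)] assms(1) by (simp add: integral_resample bounded_measurable_def)
qed

lemma cexp_const: "w \<in> space paths \<Longrightarrow> cexp k m (\<lambda>_. a) w = a"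
proof (induction m)
  case (Suc m)
  have "integral\<^sup>L (resample (k + m) v) (\<lambda>_. a) = a" if "v \<in> space paths" for v
    using kernelD(1)[OF resample_kernel that] by (simp add: prob_space.prob_space)
  then have "cexp k (Suc m) (\<lambda>_. a) w = cexp k m (\<lambda>_. a) w"
    using Suc.prems by (simp, intro cexp_cong) simp_all
  with Suc show ?case by simp
qed simp

lemma cexp_plus:
  "bounded_measurable paths h \<Longrightarrow> bounded_measurable paths g \<Longrightarrow> w \<in> space paths \<Longrightarrow>
    cexp k m (\<lambda>w. h w + g w) w = cexp k m h w + cexp k m g w"
proof (induction m arbitrary: h g)
  case (Suc m)
  have "integral\<^sup>L (resample (k + m) v) (\<lambda>w. h w + g w)
      = integral\<^sup>L (resample (k + m) v) h + integral\<^sup>L (resample (k + m) v) g" if "v \<in> space paths" for v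
    using kernel_integrable[OF resample_kernel that] Suc.prems by simp
  then have "cexp k (Suc m) (\<lambda>w. h w + g w) w =
    cexp k m (\<lambda>v. integral\<^sup>L (resample (k + m) v) h + integral\<^sup>L (resample (k + m) v) g) w"
    using Suc.prems by (simp, intro cexp_cong) simp_all
  also have "\<dots> = cexp k (Suc m) h w + cexp k (Suc m) g w"
    using Suc.prems by (simp add: Suc.IH bounded_measurable_resample)
  finally show ?case .
qed simp

lemma cexp_cmult:
  "bounded_measurable paths h \<Longrightarrow> w \<in> space paths \<Longrightarrow> cexp k m (\<lambda>w. a * h w) w = a * cexp k m h w"
proof (induction m arbitrary: h)
  case (Suc m)
  have "cexp k (Suc m) (\<lambda>w. a * h w) w = cexp k m (\<lambda>v. a * integral\<^sup>L (resample (k + m) v) h) w"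
    using Suc.prems by simp
  also have "\<dots> = a * cexp k (Suc m) h w"
    using Suc.prems by (simp add: Suc.IH bounded_measurable_resample)
  finally show ?case .
qed simp

lemma cexp_sum:
  assumes "\<And>i. i \<in> I \<Longrightarrow> bounded_measurable paths (h i)" "w \<in> space paths"
  shows "cexp k m (\<lambda>w. \<Sum>i\<in>I. h i w) w = (\<Sum>i\<in>I. cexp k m (h i) w)"
  using assms(1)
  by (induction I rule: infinite_finite_induct)
    (simp_all add: cexp_const[OF assms(2)] cexp_plus[OF _ _ assms(2)] bounded_measurable_sum)

lemma cexp_mono:
  "bounded_measurable paths h \<Longrightarrow> bounded_measurable paths g \<Longrightarrow> w \<in> space paths \<Longrightarrow>
    (\<And>w. w \<in> space paths \<Longrightarrow> h w \<le> g w) \<Longrightarrow> cexp k m h w \<le> cexp k m g w"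
proof (induction m arbitrary: h g)
  case (Suc m)
  have "integral\<^sup>L (resample (k + m) v) h \<le> integral\<^sup>L (resample (k + m) v) g" if "v \<in> space paths" for v
    using kernel_integrable[OF resample_kernel that] Suc.prems kernelD(3)[OF resample_kernel that]
    by (intro integral_mono) auto
  then show ?case
    using Suc.prems by (auto intro!: Suc.IH bounded_measurable_resample)
qed simp

lemma cexp_abs_le:
  assumes h: "bounded_measurable paths h" and "w \<in> space paths" "\<And>w. w \<in> space paths \<Longrightarrow> \<bar>h w\<bar> \<le> B"
  shows "\<bar>cexp k m h w\<bar> \<le> B"
proof -
  have "cexp k m h w \<le> cexp k m (\<lambda>_. B) w" "cexp k m (\<lambda>_. - B) w \<le> cexp k m h w"
    using assms by (auto intro!: cexp_mono bounded_measurable_const simp: abs_le_iff minus_le_iff)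
  then show ?thesis using assms(2) by (simp add: cexp_const abs_le_iff)
qed

text \<open>Coordinate \<open>Suc k\<close> is overwritten and integrated out, while
  \<open>p \<le> k\<close> keeps coordinate \<open>k\<close>, which selects the transition law,
  inside the block.\<close>

lemma depends_on_resample:
  assumes h: "depends_on M p (Suc (Suc k)) h" "bounded_measurable paths h" and "p \<le> k"
  shows "depends_on M p (Suc k) (\<lambda>w. integral\<^sup>L (resample k w) h)"
  unfolding depends_on_def
proof (intro ballI impI)
  fix w v assume *: "w \<in> space paths" "v \<in> space paths" and eq: "\<forall>i\<in>{p..<Suc k}. w i = v i"
  have "w k = v k" using eq \<open>p \<le> k\<close> by auto
  moreover have "h (w(Suc k := y)) = h (v(Suc k := y))" if "y \<in> space M" for y
    using that * eq by (intro depends_onD[OF h(1)] fun_upd_in_paths) auto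
  ultimately show "integral\<^sup>L (resample k w) h = integral\<^sup>L (resample k v) h"
    using h(2) * kernelD(3)[OF kernel in_pathsD[OF *(2)]]
    by (simp add: integral_resample bounded_measurable_def) (intro Bochner_Integration.integral_cong, auto)
qed

lemma depends_on_cexp:
  "depends_on M p (Suc (k + m)) h \<Longrightarrow> bounded_measurable paths h \<Longrightarrow> p \<le> k \<Longrightarrow> depends_on M p (Suc k) (cexp k m h)"
proof (induction m arbitrary: h)
  case (Suc m)
  then show ?case
    using depends_on_resample[of p "k + m" h] by (simp add: bounded_measurable_resample)
qed simp

section \<open>Iterated kernels and finite-dimensional laws\<close>

lemma kpow_kernel: "kpow M P m \<in> M \<rightarrow>\<^sub>M prob_algebra M"
proof (induction m)
  case 0
  have "kpow M P 0 = return M" by (rule ext) simp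
  then show ?case by simp
next
  case (Suc m)
  have "kpow M P (Suc m) = (\<lambda>x. kpow M P m x \<bind> P)" by (rule ext) simp
  then show ?case using measurable_bind_prob_space[OF Suc kernel] by simp
qed

lemma integral_bind_kernel:
  assumes Q: "prob_space Q" "sets Q = sets K" and R: "R \<in> K \<rightarrow>\<^sub>M prob_algebra K'" and h: "bounded_measurable K' h"
  shows "integral\<^sup>L (Q \<bind> R) h = (\<integral>x. integral\<^sup>L (R x) h \<partial>Q)"
proof -
  obtain B where B: "\<And>x. x \<in> space K' \<Longrightarrow> \<bar>h x\<bar> \<le> B" using h by (auto simp: bounded_measurable_def)
  show ?thesis
  proof (rule integral_bind[where K=K' and B=B and B'=1])
    show "R \<in> Q \<rightarrow>\<^sub>M subprob_algebra K'"
      using measurable_prob_algebraD[OF R] by (simp add: measurable_cong_sets[OF Q(2) refl])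
    show "AE x in Q. emeasure (R x) (space (R x)) \<le> ennreal 1"
    proof (rule AE_I2)
      fix x assume "x \<in> space Q"
      then have "x \<in> space K" using sets_eq_imp_space_eq[OF Q(2)] by simp
      then show "emeasure (R x) (space (R x)) \<le> ennreal 1"
        using prob_space.emeasure_space_1[OF kernelD(1)[OF R]] by simp
    qed
  qed (use Q h B in \<open>auto simp: bounded_measurable_def prob_space_def\<close>)
qed

text \<open>Markov property. It brings conditional expectations into the form in which the mixing
  hypothesis is given.\<close>

lemma cexp_eq_kpow:
  assumes "w \<in> space paths" "bounded_measurable M \<psi>"
  shows "cexp k m (\<lambda>v. \<psi> (v (k + m))) w = integral\<^sup>L (kpow M P m (w k)) \<psi>"
  using assms(2)
proof (induction m arbitrary: \<psi>)
  case 0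
  then show ?case
    using in_pathsD[OF assms(1), of k] by (simp add: integral_return bounded_measurable_def)
next
  case (Suc m)
  have bm: "bounded_measurable paths (\<lambda>v. \<psi> (v i))" for i
    by (rule bounded_measurable_compose[OF Suc.prems]) simp
  have "cexp k (Suc m) (\<lambda>v. \<psi> (v (k + Suc m))) w = cexp k m (\<lambda>v. integral\<^sup>L (P (v (k + m))) \<psi>) w"
    unfolding cexp.simps
  proof (rule cexp_cong)
    fix v assume v: "v \<in> space paths"
    show "(\<integral>v. \<psi> (v (k + Suc m)) \<partial>resample (k + m) v) = integral\<^sup>L (P (v (k + m))) \<psi>"
      using bm[of "k + Suc m"] v by (subst integral_resample) (auto simp: bounded_measurable_def)
  qed (rule assms)
  also have "\<dots> = integral\<^sup>L (kpow M P m (w k)) (\<lambda>x. integral\<^sup>L (P x) \<psi>)"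
    by (rule Suc.IH) (rule bounded_measurable_kernel_integral[OF kernel Suc.prems])
  also have "\<dots> = integral\<^sup>L (kpow M P (Suc m) (w k)) \<psi>"
    unfolding kpow.simps using kernelD[OF kpow_kernel in_pathsD[OF assms(1)]]
    by (intro integral_bind_kernel[OF _ _ kernel Suc.prems, symmetric]) auto
  finally show ?case .
qed

lemma chain_law_kernel_step:
  "(\<lambda>w. distr (P (w n)) (PiM {..<Suc (Suc n)} (\<lambda>_. M))
               (\<lambda>y. \<lambda>i\<in>{..<Suc (Suc n)}. if i = Suc n then y else w i))
    \<in> PiM {..<Suc n} (\<lambda>_. M) \<rightarrow>\<^sub>M prob_algebra (PiM {..<Suc (Suc n)} (\<lambda>_. M))"
proof (rule measurable_distr_prob_space2)
  show "(\<lambda>w. P (w n)) \<in> PiM {..<Suc n} (\<lambda>_. M) \<rightarrow>\<^sub>M prob_algebra M"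
    by (rule measurable_compose[OF _ kernel]) simp
  show "(\<lambda>(w, y). \<lambda>i\<in>{..<Suc (Suc n)}. if i = Suc n then y else w i)
    \<in> PiM {..<Suc n} (\<lambda>_. M) \<Otimes>\<^sub>M M \<rightarrow>\<^sub>M PiM {..<Suc (Suc n)} (\<lambda>_. M)"
    unfolding case_prod_beta
  proof (rule measurable_restrict)
    fix i assume "i \<in> {..<Suc (Suc n)}"
    then show "(\<lambda>x. if i = Suc n then snd x else fst x i) \<in> PiM {..<Suc n} (\<lambda>_. M) \<Otimes>\<^sub>M M \<rightarrow>\<^sub>M M"
      by (cases "i = Suc n") (auto intro: measurable_compose[OF measurable_fst])
  qed
qed

lemma chain_law_prob:
  assumes "prob_space \<xi>" "sets \<xi> = sets M"
  shows "chain_law M P \<xi> (Suc n) \<in> space (prob_algebra (PiM {..<Suc n} (\<lambda>_. M)))"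
proof (induction n)
  case 0
  have "(\<lambda>y. \<lambda>i\<in>{..<Suc 0}. y) \<in> \<xi> \<rightarrow>\<^sub>M PiM {..<Suc 0} (\<lambda>_. M)"
    by (intro measurable_restrict) (simp add: measurable_cong_sets[OF assms(2) refl])
  then show ?case
    using assms by (auto simp: space_prob_algebra intro!: prob_space.prob_space_distr)
next
  case (Suc n)
  show ?case
    unfolding chain_law.simps space_prob_algebra
    using prob_space_bind'[OF Suc chain_law_kernel_step] sets_bind'[OF Suc chain_law_kernel_step] by simp
qed

text \<open>The bridge from the laws of the statement to \<open>cexp\<close>. The path
  \<open>w\<close> may be arbitrary after time 0: coordinates 1 to \<open>m\<close> are integrated
  out and the later ones are cut off by \<open>restrict\<close>.\<close>

lemma integral_chain_law:
  assumes "x \<in> space M" "w \<in> space paths" "w 0 = x"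
    and "bounded_measurable (PiM {..<Suc m} (\<lambda>_. M)) h"
  shows "integral\<^sup>L (chain_law M P (return M x) (Suc m)) h = cexp 0 m (\<lambda>w. h (restrict w {..<Suc m})) w"
  using assms(4)
proof (induction m arbitrary: h)
  case 0
  have m: "(\<lambda>y. \<lambda>i\<in>{..<Suc 0}. y) \<in> M \<rightarrow>\<^sub>M PiM {..<Suc 0} (\<lambda>_. M)"
    by (intro measurable_restrict) simp
  have r: "(\<lambda>i\<in>{..<Suc 0}. x) = restrict w {..<Suc 0}" using assms(3) by auto
  have [measurable]: "h \<in> borel_measurable (PiM {..<Suc 0} (\<lambda>_. M))"
    using 0 by (simp add: bounded_measurable_def)
  then have "integral\<^sup>L (chain_law M P (return M x) (Suc 0)) h = h (\<lambda>i\<in>{..<Suc 0}. x)"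
    using m assms(1) by (simp add: integral_distr integral_return measurable_compose[OF m] del: lessThan_Suc)
  then show ?case by (simp only: r cexp.simps)
next
  case (Suc m)
  let ?K = "\<lambda>n. PiM {..<n} (\<lambda>_. M)"
  let ?R = "\<lambda>w. distr (P (w m)) (?K (Suc (Suc m)))
               (\<lambda>y. \<lambda>i\<in>{..<Suc (Suc m)}. if i = Suc m then y else w i)"
  have ret: "prob_space (return M x)" "sets (return M x) = sets M"
    using assms(1) by (auto intro: prob_space_return)
  have c: "prob_space (chain_law M P (return M x) (Suc m))" "sets (chain_law M P (return M x) (Suc m)) = sets (?K (Suc m))"
    using chain_law_prob[OF ret] by (auto simp: space_prob_algebra)
  have hm: "h \<in> borel_measurable (?K (Suc (Suc m)))" using Suc.prems by (simp add: bounded_measurable_def)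
  have "integral\<^sup>L (chain_law M P (return M x) (Suc (Suc m))) h = (\<integral>w. integral\<^sup>L (?R w) h \<partial>chain_law M P (return M x) (Suc m))"
    unfolding chain_law.simps(3) by (rule integral_bind_kernel[OF c chain_law_kernel_step Suc.prems])
  also have "\<dots> = cexp 0 m (\<lambda>w. integral\<^sup>L (?R (restrict w {..<Suc m})) h) w"
    by (rule Suc.IH) (rule bounded_measurable_kernel_integral[OF chain_law_kernel_step Suc.prems])
  also have "\<dots> = cexp 0 m (\<lambda>w. integral\<^sup>L (resample (0 + m) w) (\<lambda>w. h (restrict w {..<Suc (Suc m)}))) w"
  proof (rule cexp_cong)
    fix v assume v: "v \<in> space paths"
    note s = kernelD(2)[OF kernel in_pathsD[OF v, of m]]
    have r: "(\<lambda>w. restrict w {..<Suc (Suc m)}) \<in> paths \<rightarrow>\<^sub>M ?K (Suc (Suc m))"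
      by (rule measurable_restrict_subset) simp
    have e: "(\<lambda>i\<in>{..<Suc (Suc m)}. if i = Suc m then y else restrict v {..<Suc m} i) = restrict (v(Suc m := y)) {..<Suc (Suc m)}" for y
      by (auto simp: restrict_def)
    have u: "(\<lambda>y. restrict (v(Suc m := y)) {..<Suc (Suc m)}) \<in> M \<rightarrow>\<^sub>M ?K (Suc (Suc m))"
      using measurable_compose[OF measurable_compose[OF measurable_Pair1' measurable_fun_upd_PiM_UNIV, OF v] r, of "Suc m"] by simp
    show "integral\<^sup>L (?R (restrict v {..<Suc m})) h = integral\<^sup>L (resample (0 + m) v) (\<lambda>w. h (restrict w {..<Suc (Suc m)}))"
      using v hm u measurable_compose[OF r hm]
      by (subst integral_resample) (simp_all add: e integral_distr measurable_cong_sets[OF s refl])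
  qed (rule assms)
  finally show ?case by (simp only: cexp.simps)
qed

end

section \<open>Oscillation of the conditional expectations\<close>

context markov_kernel
begin

text \<open>Integration never touches the coordinates up to \<open>k\<close>, so agreement on the
  paths that share them with \<open>w\<close> is enough. This permits replacing \<open>f\<close> by
  an expansion around the given \<open>w\<close>.\<close>

lemma cexp_cong_prefix:
  assumes "bounded_measurable paths h" "bounded_measurable paths g"
  shows "w \<in> space paths \<Longrightarrow> (\<And>v. v \<in> space paths \<Longrightarrow> (\<And>l. l \<le> k \<Longrightarrow> v l = w l) \<Longrightarrow> h v = g v) \<Longrightarrow>
    cexp k m h w = cexp k m g w"
proof (induction m arbitrary: k w)
  case (Suc m)
  have "cexp (Suc k) m h (w(Suc k := y)) = cexp (Suc k) m g (w(Suc k := y))" if y: "y \<in> space M" for y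
  proof (rule Suc.IH)
    fix v assume "v \<in> space paths" and eq: "\<And>l. l \<le> Suc k \<Longrightarrow> v l = (w(Suc k := y)) l"
    then show "h v = g v" by (intro Suc.prems(2)) auto
  qed (rule fun_upd_in_paths[OF Suc.prems(1) y])
  then show ?case
    unfolding cexp_Suc[OF Suc.prems(1) assms(1)] cexp_Suc[OF Suc.prems(1) assms(2)]
    using kernelD(3)[OF kernel in_pathsD[OF Suc.prems(1)]]
    by (intro Bochner_Integration.integral_cong) auto
qed auto

text \<open>Replacing the coordinates of the argument one after the other by those of \<open>w\<close> writes
  \<open>f - f w\<close> as a sum of functions bounded by \<open>c\<^sub>i\<close> that only look at the path from
  time \<open>i\<close> on. Both expectations of such a term are integrals of one function of the position
  at time \<open>i\<close>, so they are compared through \<open>\<pi>\<close>.\<close>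

lemma cexp_difference_bound:
  fixes c :: "nat \<Rightarrow> real"
  assumes w: "w \<in> space paths" and f: "bounded_measurable paths f" and dep: "depends_on M 0 (Suc N) f"
    and bd: "\<And>v v'. v \<in> space paths \<Longrightarrow> v' \<in> space paths \<Longrightarrow>
      \<bar>f v - f v'\<bar> \<le> (\<Sum>i<Suc N. c i * (if v i \<noteq> v' i then 1 else 0))"
    and c: "\<And>i. i \<le> N \<Longrightarrow> 0 \<le> c i"
    and pi: "prob_space \<pi>" "sets \<pi> = sets M"
    and conv: "\<And>x m. x \<in> C \<Longrightarrow> dTV (kpow M P m x) \<pi> \<le> L * r ^ m"
    and r: "0 < r" "r < 1" and L: "0 \<le> L"
    and kj: "k \<le> j" "j \<le> N" and wC: "w k \<in> C" "j < N \<Longrightarrow> w j \<in> C"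
  shows "\<bar>cexp j (N - j) f w - cexp k (N - k) f w\<bar>
    \<le> (\<Sum>i\<in>{k..<j}. c (Suc i)) + 4 * L * (\<Sum>i\<in>{j..<N}. c (Suc i) * r ^ (Suc i - j))"
proof -
  \<comment> \<open>From \<open>mix i\<close> to \<open>mix (Suc i)\<close> only coordinate
    \<open>Suc i\<close> changes; hence \<open>\<phi> i\<close> is bounded by
    \<open>c (Suc i)\<close>, and the index is shifted by one throughout.\<close>
  define mix where "mix i v = (\<lambda>l. if l \<le> i then w l else v l)" for i :: nat and v
  define F where "F i v = f (mix i v)" for i v
  define \<phi> where "\<phi> i v = F i v - F (Suc i) v" for i v
  define \<psi> where "\<psi> i y = cexp (Suc i) (N - Suc i) (\<phi> i) (w(Suc i := y))" for i y
  have mix_paths: "mix i v \<in> space paths" if "v \<in> space paths" for i v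
    using that w by (auto simp: mix_def space_PiM PiE_iff)
  have mix_m: "mix i \<in> paths \<rightarrow>\<^sub>M paths" for i
  proof (rule measurable_PiM_single')
    show "(\<lambda>v. mix i v l) \<in> paths \<rightarrow>\<^sub>M M" for l
      using in_pathsD[OF w] by (cases "l \<le> i") (simp_all add: mix_def)
  qed (use mix_paths in \<open>auto simp: space_PiM PiE_iff\<close>)
  have F_bm: "bounded_measurable paths (F i)" for i
    unfolding F_def by (rule bounded_measurable_compose[OF f mix_m])
  have \<phi>_bm: "bounded_measurable paths (\<phi> i)" for i
    unfolding \<phi>_def by (intro bounded_measurable_diff F_bm)
  have \<phi>_le: "\<bar>\<phi> i v\<bar> \<le> c (Suc i)" if v: "v \<in> space paths" and i: "i < N" for i v
  proof -
    have "\<bar>\<phi> i v\<bar> \<le> (\<Sum>l<Suc N. c l * (if mix i v l \<noteq> mix (Suc i) v l then 1 else 0))"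
      unfolding \<phi>_def F_def by (intro bd mix_paths v)
    also have "\<dots> \<le> (\<Sum>l<Suc N. if l = Suc i then c l else 0)"
      by (intro sum_mono) (use c in \<open>auto simp: mix_def\<close>)
    also have "\<dots> = c (Suc i)" using i by (simp del: sum.lessThan_Suc)
    finally show ?thesis .
  qed
  have \<phi>_dep: "depends_on M (Suc i) (Suc N) (\<phi> i)" for i
    unfolding depends_on_def \<phi>_def F_def
    by (intro ballI impI arg_cong2[where f="(-)"] depends_onD[OF dep] mix_paths) (auto simp: mix_def)
  have \<psi>_bm: "bounded_measurable M (\<psi> i)" for i
    unfolding \<psi>_def by (intro bounded_measurable_upd w bounded_measurable_cexp \<phi>_bm)
  have \<psi>_le: "\<bar>\<psi> i y\<bar> \<le> c (Suc i)" if "y \<in> space M" "i < N" for i y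
    unfolding \<psi>_def using that w by (intro cexp_abs_le \<phi>_bm \<phi>_le fun_upd_in_paths)
  \<comment> \<open>Inside \<open>\<phi> i\<close> the coordinates up to \<open>i\<close> are those
    of the fixed \<open>w\<close>. After the times beyond \<open>Suc i\<close> are integrated out,
    only a function \<open>\<psi> i\<close> of the position at \<open>Suc i\<close> is left, the
    same one for every \<open>a\<close>.\<close>
  have t_eq: "cexp a (N - a) (\<phi> i) w = integral\<^sup>L (kpow M P (Suc i - a) (w a)) (\<psi> i)" if "a \<le> i" "i < N" for a i
  proof -
    have "N - a = (Suc i - a) + (N - Suc i)" "a + (Suc i - a) = Suc i" using that by auto
    then have "cexp a (N - a) (\<phi> i) w = cexp a (Suc i - a) (cexp (Suc i) (N - Suc i) (\<phi> i)) w"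
      using cexp_add[of a "Suc i - a" "N - Suc i" "\<phi> i"] by simp
    also have "\<dots> = cexp a (Suc i - a) (\<lambda>v. \<psi> i (v (a + (Suc i - a)))) w"
    proof (rule cexp_cong)
      fix v assume v: "v \<in> space paths"
      have d: "depends_on M (Suc i) (Suc (Suc i)) (cexp (Suc i) (N - Suc i) (\<phi> i))"
        using \<phi>_dep that by (intro depends_on_cexp \<phi>_bm) auto
      show "cexp (Suc i) (N - Suc i) (\<phi> i) v = \<psi> i (v (a + (Suc i - a)))"
        unfolding \<psi>_def using that v w
        by (intro depends_onD[OF d]) (auto intro!: fun_upd_in_paths in_pathsD simp: less_Suc_eq)
    qed (rule w)
    also have "\<dots> = integral\<^sup>L (kpow M P (Suc i - a) (w a)) (\<psi> i)"
      by (rule cexp_eq_kpow[OF w \<psi>_bm])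
    finally show ?thesis .
  qed
  \<comment> \<open>On paths that follow \<open>w\<close> up to time \<open>a\<close> the
    telescoping sum starts at \<open>f v\<close>; its other end is \<open>f w\<close>.\<close>
  have expand: "cexp a (N - a) f w = f w + (\<Sum>i\<in>{a..<N}. cexp a (N - a) (\<phi> i) w)" if a: "a \<le> N" for a
  proof -
    have "cexp a (N - a) f w = cexp a (N - a) (\<lambda>v. f w + (\<Sum>i\<in>{a..<N}. \<phi> i v)) w"
    proof (rule cexp_cong_prefix[OF f _ w])
      fix v assume v: "v \<in> space paths" and eq: "\<And>l. l \<le> a \<Longrightarrow> v l = w l"
      have "(\<Sum>i\<in>{a..<N}. \<phi> i v) = F a v - F N v"
        unfolding \<phi>_def using sum_Suc_diff'[OF a, of "\<lambda>i. - F i v"] by simp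
      moreover have "F a v = f v" unfolding F_def using v eq
        by (intro depends_onD[OF dep] mix_paths) (auto simp: mix_def)
      moreover have "F N v = f w" unfolding F_def using v w
        by (intro depends_onD[OF dep] mix_paths) (auto simp: mix_def)
      ultimately show "f v = f w + (\<Sum>i\<in>{a..<N}. \<phi> i v)" by simp
    qed (intro bounded_measurable_add bounded_measurable_sum bounded_measurable_const \<phi>_bm)
    also have "\<dots> = f w + (\<Sum>i\<in>{a..<N}. cexp a (N - a) (\<phi> i) w)"
      by (simp add: cexp_plus cexp_sum cexp_const w \<phi>_bm bounded_measurable_const bounded_measurable_sum)
    finally show ?thesis .
  qed
  let ?t = "\<lambda>a i. cexp a (N - a) (\<phi> i) w"
  \<comment> \<open>The constant 4 is 2 times 2: one factor from \<open>dTV\<close>, one from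
    passing through the \<pi>-integral. Seen from \<open>k\<close> the exponent is larger, so the
    rate from \<open>j\<close> serves for both.\<close>
  have close: "\<bar>?t j i - ?t k i\<bar> \<le> 4 * L * (c (Suc i) * r ^ (Suc i - j))" if i: "i \<in> {j..<N}" for i
  proof -
    have kp: "prob_space (kpow M P m (w l))" "sets (kpow M P m (w l)) = sets M" for m l
      using kernelD[OF kpow_kernel in_pathsD[OF w]] by auto
    have ci: "0 \<le> c (Suc i)" using c i by auto
    have le: "\<bar>?t l i - integral\<^sup>L \<pi> (\<psi> i)\<bar> \<le> 2 * c (Suc i) * (L * r ^ (Suc i - j))"
      if l: "l \<le> j" "w l \<in> C" for l
    proof -
      have "\<bar>?t l i - integral\<^sup>L \<pi> (\<psi> i)\<bar> \<le> 2 * c (Suc i) * dTV (kpow M P (Suc i - l) (w l)) \<pi>"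
        using l i by (subst t_eq) (auto intro!: integral_dist_le_dTV[OF kp(1) pi(1) kp(2) pi(2)] \<psi>_bm \<psi>_le)
      also have "\<dots> \<le> 2 * c (Suc i) * (L * r ^ (Suc i - l))"
        using ci by (intro mult_left_mono conv l) auto
      also have "\<dots> \<le> 2 * c (Suc i) * (L * r ^ (Suc i - j))"
        using ci r l L by (intro mult_left_mono power_decreasing) auto
      finally show ?thesis .
    qed
    \<comment> \<open>The presence of \<open>i\<close> forces \<open>j < N\<close>. At the horizon
      \<open>j = N\<close> the sum over \<open>i\<close> is empty, which is why no return is
      required there.\<close>
    have "w j \<in> C" using i wC by auto
    have triangle: "\<bar>a - b\<bar> \<le> 2 * x" if "\<bar>a - p\<bar> \<le> x" "\<bar>b - p\<bar> \<le> x" for a b p x :: real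
      using that by linarith
    have "\<bar>?t j i - ?t k i\<bar> \<le> 2 * (2 * c (Suc i) * (L * r ^ (Suc i - j)))"
      by (rule triangle[OF le[OF order.refl \<open>w j \<in> C\<close>] le[OF kj(1) wC(1)]])
    then show ?thesis by (simp only: mult.assoc mult.left_commute)
  qed
  \<comment> \<open>These coordinates are already fixed at time \<open>j\<close>, so their terms
    occur in the expansion from \<open>k\<close> only and have no counterpart to cancel
    with.\<close>
  have far: "\<bar>?t k i\<bar> \<le> c (Suc i)" if "i \<in> {k..<j}" for i
    using that kj w by (intro cexp_abs_le \<phi>_bm \<phi>_le) auto
  have "(\<Sum>i\<in>{k..<N}. ?t k i) = (\<Sum>i\<in>{k..<j}. ?t k i) + (\<Sum>i\<in>{j..<N}. ?t k i)"
    by (rule sum.atLeastLessThan_concat[OF kj, symmetric])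
  then have diff: "cexp j (N - j) f w - cexp k (N - k) f w = (\<Sum>i\<in>{j..<N}. ?t j i - ?t k i) - (\<Sum>i\<in>{k..<j}. ?t k i)"
    unfolding expand[OF kj(2)] expand[OF order.trans[OF kj]] sum_subtractf by linarith
  have "\<bar>cexp j (N - j) f w - cexp k (N - k) f w\<bar> \<le> (\<Sum>i\<in>{j..<N}. \<bar>?t j i - ?t k i\<bar>) + (\<Sum>i\<in>{k..<j}. \<bar>?t k i\<bar>)"
    unfolding diff by (rule order.trans[OF abs_triangle_ineq4 add_mono[OF sum_abs sum_abs]])
  also have "\<dots> \<le> 4 * L * (\<Sum>i\<in>{j..<N}. c (Suc i) * r ^ (Suc i - j)) + (\<Sum>i\<in>{k..<j}. c (Suc i))"
  proof (rule add_mono)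
    have "(\<Sum>i\<in>{j..<N}. \<bar>?t j i - ?t k i\<bar>) \<le> (\<Sum>i\<in>{j..<N}. 4 * L * (c (Suc i) * r ^ (Suc i - j)))"
      by (rule sum_mono) (rule close)
    then show "(\<Sum>i\<in>{j..<N}. \<bar>?t j i - ?t k i\<bar>) \<le> 4 * L * (\<Sum>i\<in>{j..<N}. c (Suc i) * r ^ (Suc i - j))"
      by (simp only: sum_distrib_left)
    show "(\<Sum>i\<in>{k..<j}. \<bar>?t k i\<bar>) \<le> (\<Sum>i\<in>{k..<j}. c (Suc i))"
      by (rule sum_mono) (rule far)
  qed
  finally show ?thesis by (simp only: add.commute)
qed

end

section \<open>Geometric sums and the exponential of an increment\<close>

text \<open>Taylor formula with Lagrange remainder. The linear term is kept exact because it is the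
  one that integrates to zero.\<close>

lemma exp_le_quadratic:
  fixes x d :: real
  assumes "\<bar>x\<bar> \<le> d"
  shows "exp x \<le> 1 + x + d\<^sup>2 * exp d / 2"
proof -
  obtain t where t: "\<bar>t\<bar> \<le> \<bar>x\<bar>" "exp x = (\<Sum>m<2. x ^ m / fact m) + exp t / fact 2 * x ^ 2"
    using Maclaurin_exp_le[of x 2] by auto
  have "exp t / 2 * x\<^sup>2 \<le> exp d / 2 * d\<^sup>2"
    using t(1) assms by (intro mult_mono) (auto simp: abs_le_square_iff[symmetric])
  then show ?thesis using t(2) by (simp add: numeral_2_eq_2 algebra_simps)
qed

lemma geometric_sum_le:
  fixes g :: real
  assumes g: "0 < g" "g < 1"
  shows "(\<Sum>i\<in>{k..<N}. g ^ (Suc i - k)) \<le> 1 / (1 - g)"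
proof (cases "k \<le> N")
  case True
  then have "(1 - g) * (\<Sum>i\<in>{k..<N}. g ^ (Suc i - k)) = g - g * g ^ (N - k)"
  proof (induction N rule: dec_induct)
    case (step n)
    have "(1 - g) * (\<Sum>i\<in>{k..<Suc n}. g ^ (Suc i - k))
      = (1 - g) * (\<Sum>i\<in>{k..<n}. g ^ (Suc i - k)) + (1 - g) * g ^ (Suc n - k)"
      using step(1) by (simp add: distrib_left)
    also have "\<dots> = (g - g * g ^ (n - k)) + (1 - g) * g ^ (Suc n - k)"
      by (simp only: step.IH)
    also have "\<dots> = g - g * g ^ (Suc n - k)"
      using step(1) by (simp add: algebra_simps Suc_diff_le)
    finally show ?case .
  qed (simp add: algebra_simps)
  also have "\<dots> \<le> 1"
    using g by (smt (verit) mult_nonneg_nonneg zero_le_power)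
  finally show ?thesis using g by (simp add: field_simps)
qed (use g in auto)

text \<open>The companion bound with the coordinate fixed and the starting time varying, for use
  after an exchange of summations.\<close>

lemma geometric_sum_le':
  fixes g :: real
  assumes g: "0 < g" "g < 1"
  shows "(\<Sum>l\<in>{0..i}. g ^ (Suc i - l)) \<le> 1 / (1 - g)"
proof -
  have "(1 - g) * (\<Sum>l\<in>{0..i}. g ^ (Suc i - l)) = g - g * g ^ Suc i"
  proof (induction i)
    case (Suc i)
    have "(\<Sum>l\<in>{0..i}. g ^ (Suc (Suc i) - l)) = (\<Sum>l\<in>{0..i}. g * g ^ (Suc i - l))"
      by (intro sum.cong) (auto simp: Suc_diff_le)
    then have "(\<Sum>l\<in>{0..Suc i}. g ^ (Suc (Suc i) - l)) = g * (\<Sum>l\<in>{0..i}. g ^ (Suc i - l)) + g"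
      by (simp add: sum_distrib_left)
    then have "(1 - g) * (\<Sum>l\<in>{0..Suc i}. g ^ (Suc (Suc i) - l))
      = g * ((1 - g) * (\<Sum>l\<in>{0..i}. g ^ (Suc i - l))) + (1 - g) * g"
      by (simp only: algebra_simps)
    then show ?case unfolding Suc by (simp add: algebra_simps)
  qed (simp add: algebra_simps)
  also have "\<dots> \<le> 1"
    using g by (smt (verit) mult_nonneg_nonneg zero_le_power)
  finally show ?thesis using g by (simp add: field_simps)
qed

text \<open>The two factors \<open>u powr ((j - k) / 2)\<close> hidden in \<open>u ^ (j - k)\<close> absorb
  \<open>exp d\<close> (small coefficients) and the loss \<open>\<gamma> powr (-2 * (j - k))\<close> made when the
  weights of \<open>d\<close>, which decay from time \<open>j\<close> on, are replaced by weights decaying from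
  time \<open>k\<close> on (\<open>u powr (-1/4) \<le> \<gamma>\<close>).\<close>

lemma increment_exp_bound:
  fixes c :: "nat \<Rightarrow> real"
  assumes c: "\<And>i. i \<in> {k..<N} \<Longrightarrow> 0 \<le> c (Suc i)" "\<And>i. i \<in> {k..<N} \<Longrightarrow> c (Suc i) \<le> (1 - \<gamma>)\<^sup>2 * ln u / (10 * L)"
    and r: "0 < r" "r \<le> \<gamma>" and \<gamma>: "\<gamma> < 1" "u powr (-1/4) \<le> \<gamma>" and u: "1 < u" and L: "1 \<le> L"
    and kj: "k < j" "j \<le> N"
    and d: "d = (\<Sum>i\<in>{k..<j}. c (Suc i)) + 4 * L * (\<Sum>i\<in>{j..<N}. c (Suc i) * r ^ (Suc i - j))"
  shows "d\<^sup>2 * exp d \<le> 16 * L\<^sup>2 / (1 - \<gamma>) * (\<Sum>i\<in>{k..<N}. (c (Suc i))\<^sup>2 * \<gamma> ^ (Suc i - k)) * u ^ (j - k)"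
proof -
  define S where "S = real (j - k)"
  \<comment> \<open>The 10 is 2 times (1 + 4): per unit of excursion length the first sum in
    \<open>d\<close> costs at most \<open>ln u / 10\<close> and the second
    \<open>4 * ln u / 10\<close>, together the admissible \<open>ln u / 2\<close>.\<close>
  define \<epsilon> where "\<epsilon> = (1 - \<gamma>)\<^sup>2 * ln u / (10 * L)"
  have S: "1 \<le> S" using kj by (simp add: S_def)
  have \<gamma>0: "0 < \<gamma>" using r by simp
  have lnu: "0 < ln u" using u by simp
  have \<epsilon>0: "0 \<le> \<epsilon>" using lnu L by (simp add: \<epsilon>_def)
  have \<gamma>2: "(1 - \<gamma>)\<^sup>2 \<le> 1 - \<gamma>" using \<gamma> \<gamma>0 by (simp add: power2_eq_square mult_left_le)
  have d0: "0 \<le> d" unfolding d using c(1) r L kj by (intro add_nonneg_nonneg mult_nonneg_nonneg sum_nonneg) auto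
  have "(\<Sum>i\<in>{k..<j}. c (Suc i)) \<le> S * \<epsilon>"
    using sum_bounded_above[of "{k..<j}" "\<lambda>i. c (Suc i)" \<epsilon>] c(2) kj by (auto simp: S_def \<epsilon>_def)
  also have "\<epsilon> \<le> ln u / 10"
  proof -
    have "(1 - \<gamma>)\<^sup>2 / L \<le> 1" using \<gamma>2 \<gamma>0 L by (simp add: divide_le_eq)
    then have "(1 - \<gamma>)\<^sup>2 / L * (ln u / 10) \<le> 1 * (ln u / 10)" using lnu by (intro mult_right_mono) auto
    then show ?thesis by (simp add: \<epsilon>_def)
  qed
  finally have 1: "(\<Sum>i\<in>{k..<j}. c (Suc i)) \<le> S * (ln u / 10)" using S by auto
  have "(\<Sum>i\<in>{j..<N}. c (Suc i) * r ^ (Suc i - j)) \<le> (\<Sum>i\<in>{j..<N}. \<epsilon> * \<gamma> ^ (Suc i - j))"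
    using c kj r by (intro sum_mono mult_mono power_mono) (auto simp: \<epsilon>_def[symmetric] \<epsilon>0)
  also have "\<dots> \<le> \<epsilon> * (1 / (1 - \<gamma>))"
    unfolding sum_distrib_left[symmetric] by (intro mult_left_mono geometric_sum_le \<epsilon>0 \<gamma>0 \<gamma>)
  also have "\<dots> = (1 - \<gamma>) * ln u / (10 * L)" using \<gamma> by (simp add: \<epsilon>_def power2_eq_square)
  finally have "4 * L * (\<Sum>i\<in>{j..<N}. c (Suc i) * r ^ (Suc i - j)) \<le> 4 * L * ((1 - \<gamma>) * ln u / (10 * L))"
    using L by (intro mult_left_mono) auto
  also have "\<dots> = (1 - \<gamma>) * (4 * ln u / 10)" using L by simp
  also have "\<dots> \<le> 1 * (4 * ln u / 10)" using \<gamma>0 lnu by (intro mult_right_mono) auto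
  also have "\<dots> \<le> S * (4 * ln u / 10)" using S lnu by (intro mult_right_mono) auto
  finally have "d \<le> S * (ln u / 2)" using 1 unfolding d by (simp add: algebra_simps)
  then have ed: "exp d \<le> exp (S * ln u / 2)" by simp
  let ?A = "\<Sum>i\<in>{k..<N}. c (Suc i) * \<gamma> ^ (Suc i - k)"
  have \<gamma>S: "\<gamma> ^ (Suc i - j) * \<gamma> ^ (j - k) = \<gamma> ^ (Suc i - k)" if "j \<le> i" for i
    using that kj by (simp add: power_add[symmetric])
  \<comment> \<open>Recentring of the weights at \<open>k\<close>: before \<open>j\<close> one has
    \<open>Suc i - k \<le> j - k\<close>, and from \<open>j\<close> on the exponents add up.\<close>
  have "d * \<gamma> ^ (j - k) \<le> 4 * L * ?A"
  proof -
    have "(\<Sum>i\<in>{k..<j}. c (Suc i)) * \<gamma> ^ (j - k) = (\<Sum>i\<in>{k..<j}. c (Suc i) * \<gamma> ^ (j - k))"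
      by (simp add: sum_distrib_right)
    also have "\<dots> \<le> (\<Sum>i\<in>{k..<j}. c (Suc i) * \<gamma> ^ (Suc i - k))"
      using c(1) kj \<gamma> \<gamma>0 by (intro sum_mono mult_left_mono power_decreasing) auto
    also have "\<dots> \<le> 4 * L * (\<Sum>i\<in>{k..<j}. c (Suc i) * \<gamma> ^ (Suc i - k))"
    proof -
      have "0 \<le> (\<Sum>i\<in>{k..<j}. c (Suc i) * \<gamma> ^ (Suc i - k))"
        using c(1) kj \<gamma>0 by (intro sum_nonneg) auto
      then have "1 * (\<Sum>i\<in>{k..<j}. c (Suc i) * \<gamma> ^ (Suc i - k)) \<le> 4 * L * (\<Sum>i\<in>{k..<j}. c (Suc i) * \<gamma> ^ (Suc i - k))"
        using L by (intro mult_right_mono) auto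
      then show ?thesis by simp
    qed
    finally have a: "(\<Sum>i\<in>{k..<j}. c (Suc i)) * \<gamma> ^ (j - k) \<le> 4 * L * (\<Sum>i\<in>{k..<j}. c (Suc i) * \<gamma> ^ (Suc i - k))" .
    have "(\<Sum>i\<in>{j..<N}. c (Suc i) * r ^ (Suc i - j)) * \<gamma> ^ (j - k) \<le> (\<Sum>i\<in>{j..<N}. c (Suc i) * \<gamma> ^ (Suc i - j)) * \<gamma> ^ (j - k)"
      using c(1) kj r \<gamma>0 by (intro mult_right_mono sum_mono mult_left_mono power_mono) auto
    also have "\<dots> = (\<Sum>i\<in>{j..<N}. c (Suc i) * \<gamma> ^ (Suc i - k))"
      unfolding sum_distrib_right using \<gamma>S by (intro sum.cong) (auto simp: mult.assoc)
    finally have "4 * L * ((\<Sum>i\<in>{j..<N}. c (Suc i) * r ^ (Suc i - j)) * \<gamma> ^ (j - k)) \<le> 4 * L * (\<Sum>i\<in>{j..<N}. c (Suc i) * \<gamma> ^ (Suc i - k))"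
      using L by (intro mult_left_mono) auto
    moreover have "?A = (\<Sum>i\<in>{k..<j}. c (Suc i) * \<gamma> ^ (Suc i - k)) + (\<Sum>i\<in>{j..<N}. c (Suc i) * \<gamma> ^ (Suc i - k))"
      using kj by (simp add: sum.atLeastLessThan_concat)
    ultimately show ?thesis using a unfolding d by (simp add: algebra_simps)
  qed
  then have "(d * \<gamma> ^ (j - k))\<^sup>2 \<le> (4 * L * ?A)\<^sup>2" using d0 \<gamma>0 by (intro power_mono) auto
  also have "\<dots> = 16 * L\<^sup>2 * ?A\<^sup>2" by (simp add: power_mult_distrib)
  also have "\<dots> \<le> 16 * L\<^sup>2 * ((\<Sum>i\<in>{k..<N}. (c (Suc i))\<^sup>2 * \<gamma> ^ (Suc i - k)) * (1 / (1 - \<gamma>)))"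
  proof (rule mult_left_mono)
    \<comment> \<open>Half of each weight stays with the coefficient, so that Cauchy-Schwarz returns
      the same weight in front of its square.\<close>
    have A: "?A = (\<Sum>i\<in>{k..<N}. (c (Suc i) * sqrt (\<gamma> ^ (Suc i - k))) * sqrt (\<gamma> ^ (Suc i - k)))"
      using \<gamma>0 by (simp add: mult.assoc)
    have "?A\<^sup>2 \<le> (\<Sum>i\<in>{k..<N}. (c (Suc i) * sqrt (\<gamma> ^ (Suc i - k)))\<^sup>2) * (\<Sum>i\<in>{k..<N}. (sqrt (\<gamma> ^ (Suc i - k)))\<^sup>2)"
      unfolding A by (rule Cauchy_Schwarz_ineq_sum)
    also have "\<dots> = (\<Sum>i\<in>{k..<N}. (c (Suc i))\<^sup>2 * \<gamma> ^ (Suc i - k)) * (\<Sum>i\<in>{k..<N}. \<gamma> ^ (Suc i - k))"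
      using \<gamma>0 by (simp add: power_mult_distrib)
    also have "\<dots> \<le> (\<Sum>i\<in>{k..<N}. (c (Suc i))\<^sup>2 * \<gamma> ^ (Suc i - k)) * (1 / (1 - \<gamma>))"
      using \<gamma>0 \<gamma> by (intro mult_left_mono geometric_sum_le sum_nonneg) auto
    finally show "?A\<^sup>2 \<le> (\<Sum>i\<in>{k..<N}. (c (Suc i))\<^sup>2 * \<gamma> ^ (Suc i - k)) * (1 / (1 - \<gamma>))" .
  qed simp
  finally have dg: "(d * \<gamma> ^ (j - k))\<^sup>2 \<le> 16 * L\<^sup>2 / (1 - \<gamma>) * (\<Sum>i\<in>{k..<N}. (c (Suc i))\<^sup>2 * \<gamma> ^ (Suc i - k))" (is "_ \<le> ?Q")
    by simp
  have g: "1 \<le> (\<gamma> ^ (j - k))\<^sup>2 * exp (S * ln u / 2)"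
  proof -
    have "exp (- (S * ln u / 4)) = (u powr (-1/4)) ^ (j - k)"
      using u by (simp add: powr_def S_def exp_of_nat_mult[symmetric])
    also have "\<dots> \<le> \<gamma> ^ (j - k)" using \<gamma> by (intro power_mono) auto
    finally have "(exp (- (S * ln u / 4)))\<^sup>2 \<le> (\<gamma> ^ (j - k))\<^sup>2" by (intro power_mono) auto
    moreover have "(exp (- (S * ln u / 4)))\<^sup>2 * exp (S * ln u / 2) = 1"
      by (simp add: power2_eq_square exp_add[symmetric])
    ultimately show ?thesis by (metis exp_ge_zero mult_right_mono)
  qed
  have "d\<^sup>2 * 1 \<le> d\<^sup>2 * ((\<gamma> ^ (j - k))\<^sup>2 * exp (S * ln u / 2))"
    using g by (intro mult_left_mono) auto
  also have "\<dots> = (d * \<gamma> ^ (j - k))\<^sup>2 * exp (S * ln u / 2)" by (simp add: power_mult_distrib)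
  also have "\<dots> \<le> ?Q * exp (S * ln u / 2)" using dg by (intro mult_right_mono) auto
  finally have sq: "d\<^sup>2 \<le> ?Q * exp (S * ln u / 2)" by simp
  have "d\<^sup>2 * exp d \<le> (?Q * exp (S * ln u / 2)) * exp (S * ln u / 2)"
  proof (rule mult_mono)
    show "0 \<le> ?Q * exp (S * ln u / 2)"
      by (rule mult_nonneg_nonneg[OF order.trans[OF zero_le_power2 dg] exp_ge_zero])
  qed (use ed sq in auto)
  also have "\<dots> = ?Q * exp (S * ln u)" by (simp add: exp_add[symmetric])
  also have "exp (S * ln u) = u ^ (j - k)" using u by (simp add: S_def exp_of_nat_mult)
  finally show ?thesis .
qed

section \<open>Return times\<close>

context markov_kernel
begin

text \<open>One step of the chain killed on \<open>C\<close>.\<close>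

definition avoid :: "'a set \<Rightarrow> ('a \<Rightarrow> ennreal) \<Rightarrow> 'a \<Rightarrow> ennreal" where
  "avoid C \<phi> x = (\<integral>\<^sup>+y. indicator (space M - C) y * \<phi> y \<partial>P x)"

text \<open>\<open>hit_weight C u m x\<close> is the expectation under \<open>P\<^sub>x\<close> of
  \<open>u ^ min \<sigma>\<^sub>C m\<close>, written through its first-step recursion.\<close>

primrec hit_weight :: "'a set \<Rightarrow> real \<Rightarrow> nat \<Rightarrow> 'a \<Rightarrow> real" where
  "hit_weight C u 0 x = 1"
| "hit_weight C u (Suc m) x = u * (\<integral>y. (if y \<in> C then 1 else hit_weight C u m y) \<partial>P x)"

lemma nn_integral_kernel_measurable:
  assumes "\<phi> \<in> borel_measurable M"
  shows "(\<lambda>x. \<integral>\<^sup>+y. \<phi> y \<partial>P x) \<in> borel_measurable M"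
  by (rule measurable_compose[OF measurable_prob_algebraD[OF kernel] nn_integral_measurable_subprob_algebra[OF assms]])

lemma avoid_measurable:
  assumes "C \<in> sets M" "\<phi> \<in> borel_measurable M"
  shows "avoid C \<phi> \<in> borel_measurable M"
proof -
  have "(\<lambda>y. indicator (space M - C) y * \<phi> y) \<in> borel_measurable M"
    using assms by auto
  from nn_integral_kernel_measurable[OF this] show ?thesis
    by (simp add: avoid_def[abs_def])
qed

section \<open>The law of the return time through the killed kernel\<close>

lemma nn_integral_chain_law_Suc:
  assumes \<xi>: "prob_space \<xi>" "sets \<xi> = sets M"
    and h: "h \<in> borel_measurable (PiM {..<Suc (Suc n)} (\<lambda>_. M))"
  shows "(\<integral>\<^sup>+w. h w \<partial>chain_law M P \<xi> (Suc (Suc n))) =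
    (\<integral>\<^sup>+w. \<integral>\<^sup>+y. h (\<lambda>i\<in>{..<Suc (Suc n)}. if i = Suc n then y else w i) \<partial>P (w n) \<partial>chain_law M P \<xi> (Suc n))"
proof -
  let ?K = "\<lambda>n. PiM {..<n} (\<lambda>_. M)"
  have c: "sets (chain_law M P \<xi> (Suc n)) = sets (?K (Suc n))"
    using chain_law_prob[OF \<xi>] by (auto simp: space_prob_algebra)
  let ?R = "\<lambda>w. distr (P (w n)) (?K (Suc (Suc n))) (\<lambda>y. \<lambda>i\<in>{..<Suc (Suc n)}. if i = Suc n then y else w i)"
  have "(\<integral>\<^sup>+w. h w \<partial>chain_law M P \<xi> (Suc (Suc n))) = (\<integral>\<^sup>+w. \<integral>\<^sup>+v. h v \<partial>?R w \<partial>chain_law M P \<xi> (Suc n))"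
    unfolding chain_law.simps(3)
    by (rule nn_integral_bind[OF h])
       (use measurable_prob_algebraD[OF chain_law_kernel_step] in \<open>simp add: measurable_cong_sets[OF c refl]\<close>)
  also have "\<dots> = (\<integral>\<^sup>+w. \<integral>\<^sup>+y. h (\<lambda>i\<in>{..<Suc (Suc n)}. if i = Suc n then y else w i) \<partial>P (w n) \<partial>chain_law M P \<xi> (Suc n))"
  proof (rule nn_integral_cong)
    fix w assume "w \<in> space (chain_law M P \<xi> (Suc n))"
    then have w: "w \<in> space (?K (Suc n))" using sets_eq_imp_space_eq[OF c] by simp
    then have wi: "w i \<in> space M" if "i < Suc n" for i using that by (auto simp: space_PiM PiE_iff)
    have "(\<lambda>y. \<lambda>i\<in>{..<Suc (Suc n)}. if i = Suc n then y else w i) \<in> M \<rightarrow>\<^sub>M ?K (Suc (Suc n))"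
    proof (rule measurable_restrict)
      fix i assume "i \<in> {..<Suc (Suc n)}"
      then show "(\<lambda>y. if i = Suc n then y else w i) \<in> M \<rightarrow>\<^sub>M M"
        using wi[of i] by (cases "i = Suc n") auto
    qed
    moreover note s = kernelD(2)[OF kernel wi[of n]]
    ultimately show "(\<integral>\<^sup>+v. h v \<partial>?R w) = (\<integral>\<^sup>+y. h (\<lambda>i\<in>{..<Suc (Suc n)}. if i = Suc n then y else w i) \<partial>P (w n))"
      using h by (subst nn_integral_distr) (simp_all add: measurable_cong_sets[OF s refl])
  qed
  finally show ?thesis .
qed

text \<open>\<open>chain_law\<close> grows at its last coordinate, whereas powers of
  \<open>avoid\<close> are read from the first step. Keeping \<phi> arbitrary reconciles them: the
  last transition is absorbed into \<phi> before the induction hypothesis is used. Time 0 is exempt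
  from avoiding \<open>C\<close>, as the start lies in \<open>C\<close> later.\<close>

lemma nn_integral_chain_law_avoid:
  assumes C: "C \<in> sets M" and x: "x \<in> space M"
  shows "\<phi> \<in> borel_measurable M \<Longrightarrow>
    (\<integral>\<^sup>+w. (if \<forall>i\<in>{1..<Suc k}. w i \<notin> C then \<phi> (w (Suc k)) else 0) \<partial>chain_law M P (return M x) (Suc (Suc k)))
     = (avoid C ^^ k) (\<lambda>z. \<integral>\<^sup>+y. \<phi> y \<partial>P z) x"
proof (induction k arbitrary: \<phi>)
  have ret: "prob_space (return M x)" "sets (return M x) = sets M"
    using x by (auto intro: prob_space_return)
  let ?K = "\<lambda>n. PiM {..<n} (\<lambda>_. M)"
  have meas: "(\<lambda>w. if \<forall>i\<in>{1..<Suc k}. w i \<notin> C then \<phi> (w (Suc k)) else 0) \<in> borel_measurable (?K (Suc (Suc k)))"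
    if [measurable]: "\<phi> \<in> borel_measurable M" for \<phi> :: "'a \<Rightarrow> ennreal" and k
  proof (rule measurable_If)
    have "{w \<in> space (?K (Suc (Suc k))). w i \<in> C} \<in> sets (?K (Suc (Suc k)))" if "i \<in> {1..<Suc k}" for i
      using C that by (intro sets_Collect_single) auto
    then show "{w \<in> space (?K (Suc (Suc k))). \<forall>i\<in>{1..<Suc k}. w i \<notin> C} \<in> sets (?K (Suc (Suc k)))"
      by (intro sets.sets_Collect_finite_All sets.sets_Collect_neg) auto
    have "(\<lambda>w. w (Suc k)) \<in> ?K (Suc (Suc k)) \<rightarrow>\<^sub>M M" by (rule measurable_component_singleton) simp
    from measurable_compose[OF this that] show "(\<lambda>w. \<phi> (w (Suc k))) \<in> borel_measurable (?K (Suc (Suc k)))" .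
  qed simp
  {
    case 0
    have m: "(\<lambda>y. \<lambda>i\<in>{..<Suc 0}. y) \<in> M \<rightarrow>\<^sub>M ?K (Suc 0)"
      by (intro measurable_restrict) simp
    have g: "(\<lambda>w. \<integral>\<^sup>+y. \<phi> y \<partial>P (w 0)) \<in> borel_measurable (?K (Suc 0))"
      by (rule measurable_compose[OF _ nn_integral_kernel_measurable[OF 0]]) simp
    have "(\<integral>\<^sup>+w. (if \<forall>i\<in>{1..<Suc 0}. w i \<notin> C then \<phi> (w (Suc 0)) else 0) \<partial>chain_law M P (return M x) (Suc (Suc 0)))
      = (\<integral>\<^sup>+w. \<integral>\<^sup>+y. \<phi> y \<partial>P (w 0) \<partial>chain_law M P (return M x) (Suc 0))"
      by (subst nn_integral_chain_law_Suc[OF ret meas[OF 0]]) simp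
    also have "\<dots> = (\<integral>\<^sup>+z. \<integral>\<^sup>+y. \<phi> y \<partial>P z \<partial>return M x)"
      unfolding chain_law.simps by (subst nn_integral_distr) (use m g in \<open>simp_all del: lessThan_Suc\<close>)
    also have "\<dots> = (\<integral>\<^sup>+y. \<phi> y \<partial>P x)"
      by (rule nn_integral_return[OF x nn_integral_kernel_measurable[OF 0]])
    finally show ?case by simp
  next
    case (Suc k)
    let ?K\<phi> = "\<lambda>z. \<integral>\<^sup>+y. \<phi> y \<partial>P z"
    have K\<phi>: "?K\<phi> \<in> borel_measurable M" by (rule nn_integral_kernel_measurable[OF Suc.prems])
    have K\<phi>': "(\<lambda>z. indicator (space M - C) z * ?K\<phi> z) \<in> borel_measurable M"
      using C K\<phi> by auto
    have c: "space (chain_law M P (return M x) (Suc (Suc k))) = space (?K (Suc (Suc k)))"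
      using chain_law_prob[OF ret, of "Suc k"] by (auto simp: space_prob_algebra dest: sets_eq_imp_space_eq)
    have "(\<integral>\<^sup>+w. (if \<forall>i\<in>{1..<Suc (Suc k)}. w i \<notin> C then \<phi> (w (Suc (Suc k))) else 0) \<partial>chain_law M P (return M x) (Suc (Suc (Suc k))))
      = (\<integral>\<^sup>+w. \<integral>\<^sup>+y. (if \<forall>i\<in>{1..<Suc (Suc k)}. w i \<notin> C then \<phi> y else 0) \<partial>P (w (Suc k)) \<partial>chain_law M P (return M x) (Suc (Suc k)))"
      by (subst nn_integral_chain_law_Suc[OF ret meas[OF Suc.prems]])
         (intro nn_integral_cong, auto intro!: arg_cong2[where f=If])
    also have "\<dots> = (\<integral>\<^sup>+w. (if \<forall>i\<in>{1..<Suc k}. w i \<notin> C then indicator (space M - C) (w (Suc k)) * ?K\<phi> (w (Suc k)) else 0)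
        \<partial>chain_law M P (return M x) (Suc (Suc k)))"
    proof (rule nn_integral_cong)
      fix w assume "w \<in> space (chain_law M P (return M x) (Suc (Suc k)))"
      then have w: "w (Suc k) \<in> space M" unfolding c by (auto simp: space_PiM PiE_iff)
      define A where "A \<longleftrightarrow> (\<forall>i\<in>{1..<Suc k}. w i \<notin> C)"
      have eq: "(\<forall>i\<in>{1..<Suc (Suc k)}. w i \<notin> C) \<longleftrightarrow> A \<and> w (Suc k) \<notin> C"
        by (auto simp: A_def less_Suc_eq)
      show "(\<integral>\<^sup>+y. (if \<forall>i\<in>{1..<Suc (Suc k)}. w i \<notin> C then \<phi> y else 0) \<partial>P (w (Suc k)))
        = (if \<forall>i\<in>{1..<Suc k}. w i \<notin> C then indicator (space M - C) (w (Suc k)) * ?K\<phi> (w (Suc k)) else 0)"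
        unfolding eq unfolding A_def[symmetric] using w by (cases A) (simp_all split: split_indicator)
    qed
    also have "\<dots> = (avoid C ^^ k) (\<lambda>z. \<integral>\<^sup>+y. indicator (space M - C) y * ?K\<phi> y \<partial>P z) x"
      by (rule Suc.IH[OF K\<phi>'])
    also have "(\<lambda>z. \<integral>\<^sup>+y. indicator (space M - C) y * ?K\<phi> y \<partial>P z) = avoid C ?K\<phi>"
      by (simp add: avoid_def[abs_def])
    finally show ?case by (simp add: funpow_swap1)
  }
qed

text \<open>Taboo formula: \<open>k\<close> steps outside \<open>C\<close>, followed by one step
  into it.\<close>

lemma hit_prob_eq_avoid:
  assumes C: "C \<in> sets M" and x: "x \<in> space M"
  shows "hit_prob M P x C (Suc k) = (avoid C ^^ k) (\<lambda>z. emeasure (P z) C) x"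
proof -
  let ?K = "PiM {..<Suc (Suc k)} (\<lambda>_. M)"
  let ?A = "{w \<in> space ?K. (\<forall>i\<in>{1..<Suc k}. w i \<notin> C) \<and> w (Suc k) \<in> C}"
  have ret: "prob_space (return M x)" "sets (return M x) = sets M"
    using x by (auto intro: prob_space_return)
  have c: "sets (chain_law M P (return M x) (Suc (Suc k))) = sets ?K"
    using chain_law_prob[OF ret, of "Suc k"] by (auto simp: space_prob_algebra)
  have "{w \<in> space ?K. w i \<in> C} \<in> sets ?K" if "i < Suc (Suc k)" for i
    using C that by (intro sets_Collect_single) auto
  then have A: "?A \<in> sets ?K"
    by (intro sets.sets_Collect_conj sets.sets_Collect_finite_All sets.sets_Collect_neg) auto
  have "hit_prob M P x C (Suc k) = (\<integral>\<^sup>+w. indicator ?A w \<partial>chain_law M P (return M x) (Suc (Suc k)))"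
    unfolding hit_prob_def using A c by simp
  also have "\<dots> = (\<integral>\<^sup>+w. (if \<forall>i\<in>{1..<Suc k}. w i \<notin> C then indicator C (w (Suc k)) else 0) \<partial>chain_law M P (return M x) (Suc (Suc k)))"
    by (intro nn_integral_cong) (auto simp: sets_eq_imp_space_eq[OF c] simp del: chain_law.simps split: split_indicator)
  also have "\<dots> = (avoid C ^^ k) (\<lambda>z. \<integral>\<^sup>+y. indicator C y \<partial>P z) x"
    using C by (intro nn_integral_chain_law_avoid[OF C x]) auto
  also have "\<dots> = (avoid C ^^ k) (\<lambda>z. emeasure (P z) C) x"
  proof -
    have cong: "(avoid C ^^ k) f y = (avoid C ^^ k) g y" if "\<And>y. y \<in> space M \<Longrightarrow> f y = g y" "y \<in> space M" for f g y
      using that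
    proof (induction k arbitrary: y)
      case (Suc k)
      then show ?case
        using kernelD(3)[OF kernel, of y] by (auto simp: avoid_def intro!: nn_integral_cong)
    qed simp
    have "(\<integral>\<^sup>+y. indicator C y \<partial>P z) = emeasure (P z) C" if "z \<in> space M" for z
      using C kernelD(2)[OF kernel that] by (subst nn_integral_indicator) auto
    then show ?thesis by (intro cong x)
  qed
  finally show ?thesis .
qed

lemma hit_weight_bounds:
  assumes C: "C \<in> sets M" and u: "1 \<le> u"
  shows "bounded_measurable M (hit_weight C u m) \<and> (\<forall>x\<in>space M. 0 \<le> hit_weight C u m x)"
proof (induction m)
  case 0
  have "hit_weight C u 0 = (\<lambda>_. 1)" by (rule ext) simp
  then show ?case by (simp add: bounded_measurable_const)
next
  case (Suc m)
  let ?g = "\<lambda>y. if y \<in> C then 1 else hit_weight C u m y"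
  have g: "bounded_measurable M ?g"
    using bounded_measurable_If_one[OF C] Suc by blast
  have "hit_weight C u (Suc m) = (\<lambda>x. u * integral\<^sup>L (P x) ?g)" by (rule ext) simp
  then have "bounded_measurable M (hit_weight C u (Suc m))"
    by (simp only:) (intro bounded_measurable_mult bounded_measurable_const bounded_measurable_kernel_integral[OF kernel g])
  moreover have "0 \<le> hit_weight C u (Suc m) x" if "x \<in> space M" for x
    using u Suc kernelD(3)[OF kernel that] by (auto intro!: mult_nonneg_nonneg integral_nonneg_AE AE_I2)
  ultimately show ?case by blast
qed

lemma bounded_measurable_stopped_weight:
  assumes "C \<in> sets M" "1 \<le> u"
  shows "bounded_measurable M (\<lambda>y. if y \<in> C then 1 else hit_weight C u m y)"
  using bounded_measurable_If_one[OF assms(1)] hit_weight_bounds[OF assms] by blast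

lemma avoid_funpow_measurable:
  assumes "C \<in> sets M" "\<phi> \<in> borel_measurable M"
  shows "(avoid C ^^ k) \<phi> \<in> borel_measurable M"
  by (induction k) (simp_all add: assms avoid_measurable)

lemma emeasure_kernel_split:
  assumes C: "C \<in> sets M" and x: "x \<in> space M" and g: "g \<in> borel_measurable M"
  shows "(\<integral>\<^sup>+y. (if y \<in> C then 1 else g y) \<partial>P x) = emeasure (P x) C + avoid C g x"
proof -
  note s = kernelD[OF kernel x]
  have "(\<integral>\<^sup>+y. (if y \<in> C then 1 else g y) \<partial>P x) = (\<integral>\<^sup>+y. indicator C y + indicator (space M - C) y * g y \<partial>P x)"
    using s(3) by (intro nn_integral_cong) (auto split: split_indicator)
  also have "\<dots> = emeasure (P x) C + avoid C g x"
    using C g by (subst nn_integral_add) (auto simp: avoid_def measurable_cong_sets[OF s(2) refl] s(2))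
  finally show ?thesis .
qed

lemma avoid_add_cmult_sum:
  assumes "C \<in> sets M" "x \<in> space M" "finite I"
    and "\<And>i. i \<in> I \<Longrightarrow> f i \<in> borel_measurable M" "g \<in> borel_measurable M"
  shows "avoid C (\<lambda>y. (\<Sum>i\<in>I. a i * f i y) + b * g y) x = (\<Sum>i\<in>I. a i * avoid C (f i) x) + b * avoid C g x"
proof -
  note s = measurable_cong_sets[OF kernelD(2)[OF kernel assms(2)] refl]
  have "avoid C (\<lambda>y. (\<Sum>i\<in>I. a i * f i y) + b * g y) x
    = (\<integral>\<^sup>+y. (\<Sum>i\<in>I. a i * (indicator (space M - C) y * f i y)) + b * (indicator (space M - C) y * g y) \<partial>P x)"
    unfolding avoid_def by (intro nn_integral_cong) (simp add: distrib_left sum_distrib_left mult_ac)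
  also have "\<dots> = (\<Sum>i\<in>I. a i * avoid C (f i) x) + b * avoid C g x"
    unfolding avoid_def using assms
    by (subst nn_integral_add)
       (auto simp: s nn_integral_sum nn_integral_cmult intro!: borel_measurable_sum borel_measurable_times_ennreal)
  finally show ?thesis .
qed

text \<open>\<open>H k\<close> is the probability that the return time is \<open>k + 1\<close>, and
  \<open>S m\<close> that it exceeds \<open>m\<close>. The two parts of the right-hand side are the
  events of a return by time \<open>m\<close> and of no return by then.\<close>

lemma hit_weight_eq:
  assumes C: "C \<in> sets M" and u: "1 \<le> u"
  defines "H \<equiv> \<lambda>k. (avoid C ^^ k) (\<lambda>z. emeasure (P z) C)"
    and "S \<equiv> \<lambda>m. (avoid C ^^ m) (\<lambda>_. 1)"
  shows "x \<in> space M \<Longrightarrow> ennreal (hit_weight C u m x) = (\<Sum>k<m. ennreal (u ^ Suc k) * H k x) + ennreal (u ^ m) * S m x"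
proof (induction m arbitrary: x)
  case 0
  then show ?case by (simp add: S_def)
next
  case (Suc m)
  note hw = hit_weight_bounds[OF C u, of m]
  have P_m: "(\<lambda>z. emeasure (P z) C) \<in> borel_measurable M"
    using measurable_compose[OF measurable_prob_algebraD[OF kernel] measurable_emeasure_subprob_algebra[OF C]] .
  have H: "H k \<in> borel_measurable M" "S k \<in> borel_measurable M" for k
    unfolding H_def S_def by (intro avoid_funpow_measurable[OF C] P_m; simp)+
  have "ennreal (hit_weight C u (Suc m) x) = ennreal u * ennreal (\<integral>y. (if y \<in> C then 1 else hit_weight C u m y) \<partial>P x)"
    using u by (simp add: ennreal_mult')
  also have "ennreal (\<integral>y. (if y \<in> C then 1 else hit_weight C u m y) \<partial>P x) = (\<integral>\<^sup>+y. ennreal (if y \<in> C then 1 else hit_weight C u m y) \<partial>P x)"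
    using hw kernelD(3)[OF kernel Suc.prems]
    by (intro nn_integral_eq_integral[symmetric] kernel_integrable[OF kernel Suc.prems bounded_measurable_stopped_weight[OF C u]] AE_I2) auto
  also have "\<dots> = (\<integral>\<^sup>+y. (if y \<in> C then 1 else (\<Sum>k<m. ennreal (u ^ Suc k) * H k y) + ennreal (u ^ m) * S m y) \<partial>P x)"
    using kernelD(3)[OF kernel Suc.prems] Suc.IH by (intro nn_integral_cong) auto
  also have "\<dots> = emeasure (P x) C + ((\<Sum>k<m. ennreal (u ^ Suc k) * H (Suc k) x) + ennreal (u ^ m) * S (Suc m) x)"
    using H by (subst emeasure_kernel_split[OF C Suc.prems])
      (auto simp: avoid_add_cmult_sum[OF C Suc.prems] H_def S_def)
  also have "ennreal u * \<dots> = (\<Sum>k<Suc m. ennreal (u ^ Suc k) * H k x) + ennreal (u ^ Suc m) * S (Suc m) x"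
    unfolding sum.lessThan_Suc_shift using u
    by (simp add: distrib_left sum_distrib_left ennreal_mult H_def mult.assoc add.assoc)
  finally show ?case .
qed

text \<open>Finiteness of \<open>exp_hit\<close> forces almost sure return, since otherwise its
  infinite term would be present. The mass not yet returned by time \<open>m\<close> then returns
  later, where its weight is at least \<open>u ^ m\<close>.\<close>

lemma hit_weight_le_exp_hit:
  assumes C: "C \<in> sets M" and u: "1 \<le> u" and x: "x \<in> space M" and fin: "exp_hit M P x C u < \<top>"
  shows "ennreal (hit_weight C u m x) \<le> exp_hit M P x C u"
proof -
  define h where "h k = hit_prob M P x C (Suc k)" for k
  define q where "q = (avoid C ^^ m) (\<lambda>_. 1) x"
  have h: "(avoid C ^^ k) (\<lambda>z. emeasure (P z) C) x = h k" for k
    unfolding h_def by (rule hit_prob_eq_avoid[OF C x, symmetric])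
  \<comment> \<open>For \<open>u = 1\<close> the weight is the total mass, so
    \<open>hit_weight_eq\<close> becomes the partition of unity \<open>sum1\<close>.\<close>
  have one: "hit_weight C 1 m y = 1" if "y \<in> space M" for y
    using that
  proof (induction m arbitrary: y)
    case (Suc m)
    have "(\<integral>z. (if z \<in> C then 1 else hit_weight C 1 m z) \<partial>P y) = (\<integral>z. 1 \<partial>P y)"
      using kernelD(3)[OF kernel Suc.prems] Suc.IH by (intro Bochner_Integration.integral_cong) auto
    then show ?case using kernelD(1)[OF kernel Suc.prems] by (simp add: prob_space.prob_space)
  qed simp
  have sum1: "(\<Sum>k<m. h k) + q = 1"
    using hit_weight_eq[OF C order.refl x, of m] one[OF x] by (simp add: h q_def)
  have "1 \<le> (\<Sum>k. h k)"
  proof (rule ccontr)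
    assume "\<not> 1 \<le> (\<Sum>k. h k)"
    then have "1 - (\<Sum>k. h k) \<noteq> 0" by (simp add: diff_eq_0_iff_ennreal)
    then have "\<top> * (1 - (\<Sum>k. h k)) = \<top>" by (simp add: ennreal_top_mult)
    then show False using fin by (simp add: exp_hit_def h_def)
  qed
  also have "(\<Sum>k. h k) = (\<Sum>k<m. h k) + (\<Sum>k. h (k + m))"
    by (subst suminf_offset[of h m]) (auto simp: add.commute)
  finally have "(\<Sum>k<m. h k) + q \<le> (\<Sum>k<m. h k) + (\<Sum>k. h (k + m))" using sum1 by simp
  moreover have "(\<Sum>k<m. h k) \<le> 1" using sum1 by (metis le_iff_add)
  ultimately have q: "q \<le> (\<Sum>k. h (k + m))"
    unfolding ennreal_add_left_cancel_le by (metis ennreal_one_neq_top infinity_ennreal_def top_unique)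
  have "ennreal (hit_weight C u m x) = (\<Sum>k<m. ennreal (u ^ Suc k) * h k) + ennreal (u ^ m) * q"
    using hit_weight_eq[OF C u x, of m] by (simp add: h q_def)
  also have "ennreal (u ^ m) * q \<le> (\<Sum>k. ennreal (u ^ m) * h (k + m))"
    using q by (simp add: mult_left_mono)
  also have "\<dots> \<le> (\<Sum>k. ennreal (u ^ Suc (k + m)) * h (k + m))"
    using u by (intro suminf_le mult_right_mono ennreal_leI power_increasing) auto
  also have "(\<Sum>k<m. ennreal (u ^ Suc k) * h k) + \<dots> = (\<Sum>k. ennreal (u ^ Suc k) * h k)"
    by (subst suminf_offset[of "\<lambda>k. ennreal (u ^ Suc k) * h k" m]) (auto simp: add.commute)
  also have "\<dots> \<le> exp_hit M P x C u"
    unfolding exp_hit_def h_def by simp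
  finally show ?thesis by (simp add: add_left_mono)
qed

end

section \<open>Exponential moments\<close>

context markov_kernel
begin

text \<open>Two nested backward inductions: the outer over visits \<open>k\<close> to
  \<open>C\<close>, the inner over the times \<open>j\<close> until the next visit or the horizon
  \<open>N\<close>. \<open>q k\<close> is the cost of an excursion starting at \<open>k\<close>; as
  the visit times are random, every time is charged.\<close>

lemma cexp_exp_le:
  assumes C: "C \<in> sets M" and u: "1 \<le> u" and f: "bounded_measurable paths f" and dep: "depends_on M 0 (Suc N) f"
    and hw: "\<And>m x. x \<in> C \<Longrightarrow> hit_weight C u m x \<le> Mc"
    and q: "\<And>k. 0 \<le> q k" and Mc: "0 \<le> Mc"
    and inc: "\<And>k j w. w \<in> space paths \<Longrightarrow> k < j \<Longrightarrow> j \<le> N \<Longrightarrow> w k \<in> C \<Longrightarrow> (j < N \<Longrightarrow> w j \<in> C) \<Longrightarrow>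
      exp (cexp j (N - j) f w - cexp k (N - k) f w)
        \<le> 1 + (cexp j (N - j) f w - cexp k (N - k) f w) + q k * u ^ (j - k)"
  shows "k \<le> N \<Longrightarrow> w \<in> space paths \<Longrightarrow> w k \<in> C \<Longrightarrow>
    cexp k (N - k) (\<lambda>w. exp (f w)) w \<le> exp (cexp k (N - k) f w + Mc * (\<Sum>l\<in>{k..<N}. q l))"
proof (induction "N - k" arbitrary: k w rule: less_induct)
  case less
  note outer = less.hyps
  define g where "g j w = cexp j (N - j) f w" for j w
  define V where "V j w = cexp j (N - j) (\<lambda>w. exp (f w)) w" for j w
  show ?case
  proof (cases "k = N")
    case True
    then show ?thesis by simp
  next
    case False
    then have kN: "k < N" using less.prems by simp
    \<comment> \<open>At a return \<open>j\<close> the outer hypothesis gives a sum starting at the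
      random time \<open>j\<close>. Enlarging it to start at \<open>Suc k\<close> makes the factor
      deterministic, so that it leaves the integrals.\<close>
    define E where "E = exp (Mc * (\<Sum>l\<in>{Suc k..<N}. q l))"
    \<comment> \<open>Mean of \<open>u\<close> to the remaining excursion length, with at most
      \<open>m\<close> steps left; it is 1 in \<open>C\<close> and also at the horizon, where
      \<open>m = 0\<close>.\<close>
    define stop where "stop m y = (if y \<in> C then 1 else hit_weight C u m y)" for m y
    \<comment> \<open>After time \<open>k\<close> the estimate is carried back from the next return \<open>j\<close> to \<open>C\<close> (or from \<open>N\<close>):
      it is affine in \<open>g\<close> and in \<open>u ^ (j - k)\<close>, hence stable under integration.\<close>
    define bound where "bound s j w = E * exp (g k w) * (1 + (g j w - g k w) + q k * u ^ (j - k) * s)" for s j w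
    have E0: "0 < E" by (simp add: E_def)
    have f_exp: "bounded_measurable paths (\<lambda>w. exp (f w))" by (rule bounded_measurable_exp[OF f])
    have g_dep: "g k (w(Suc j := y)) = g k w" if "w \<in> space paths" "y \<in> space M" "k \<le> j" for w j y
      unfolding g_def using that kN dep
      by (intro depends_onD[OF depends_on_cexp[of 0 k "N - k" f]]) (auto intro: f fun_upd_in_paths simp del: fun_upd_apply, auto)
    have stop_bm: "bounded_measurable M (stop m)" for m
      unfolding stop_def using bounded_measurable_stopped_weight[OF C u] .
    \<comment> \<open>The conclusion has \<open>hit_weight\<close> in place of \<open>stop\<close>
      so that it also covers \<open>j = k\<close>, where the path is in \<open>C\<close> but the
      excursion has yet to begin.\<close>
    have step: "V j w \<le> bound (hit_weight C u (N - j) (w j)) j w"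
      if j: "k \<le> j" "j < N" and w: "w \<in> space paths" "w k \<in> C"
        and next_le: "\<And>v. v \<in> space paths \<Longrightarrow> v k \<in> C \<Longrightarrow> V (Suc j) v \<le> bound (stop (N - Suc j) (v (Suc j))) (Suc j) v"
      for j w
    proof -
      let ?up = "\<lambda>y. w(Suc j := y)"
      have Nj: "N - j = Suc (N - Suc j)" using j by simp
      note K = kernelD[OF kernel in_pathsD[OF w(1), of j]]
      interpret Pw: prob_space "P (w j)" by (rule K(1))
      have int: "integrable (P (w j)) h" if "bounded_measurable M h" for h
        by (rule kernel_integrable[OF kernel in_pathsD[OF w(1)] that])
      have bms: "bounded_measurable M (\<lambda>y. V (Suc j) (?up y))" "bounded_measurable M (\<lambda>y. g (Suc j) (?up y))"
        unfolding V_def g_def by (intro bounded_measurable_upd w bounded_measurable_cexp f f_exp)+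
      define R where "R y = E * exp (g k w) * (1 + (g (Suc j) (?up y) - g k w) + q k * u ^ (Suc j - k) * stop (N - Suc j) y)" for y
      have R_bm: "bounded_measurable M R" unfolding R_def
        by (intro bounded_measurable_add bounded_measurable_mult bounded_measurable_diff bounded_measurable_const bms stop_bm)
      have "V j w = (\<integral>y. V (Suc j) (?up y) \<partial>P (w j))"
        unfolding V_def Nj by (rule cexp_Suc[OF w(1) f_exp])
      also have "\<dots> \<le> (\<integral>y. R y \<partial>P (w j))"
      proof (rule integral_mono[OF int[OF bms(1)] int[OF R_bm]])
        fix y assume "y \<in> space (P (w j))"
        then have y: "y \<in> space M" using K(3) by simp
        have "V (Suc j) (?up y) \<le> bound (stop (N - Suc j) ((?up y) (Suc j))) (Suc j) (?up y)"
          using w y j by (intro next_le fun_upd_in_paths) auto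
        then show "V (Suc j) (?up y) \<le> R y"
          unfolding bound_def R_def g_dep[OF w(1) y j(1)] by simp
      qed
      also have "\<dots> = E * exp (g k w) * (1 + ((\<integral>y. g (Suc j) (?up y) \<partial>P (w j)) - g k w)
          + q k * u ^ (Suc j - k) * (\<integral>y. stop (N - Suc j) y \<partial>P (w j)))"
        unfolding R_def using int[OF bms(2)] int[OF stop_bm] by (simp add: Pw.prob_space)
      also have "(\<integral>y. g (Suc j) (?up y) \<partial>P (w j)) = g j w"
        unfolding g_def Nj by (rule cexp_Suc[OF w(1) f, symmetric])
      \<comment> \<open>The extra factor \<open>u\<close> is the one in the first-step recursion of
        \<open>hit_weight\<close>.\<close>
      also have "q k * u ^ (Suc j - k) * (\<integral>y. stop (N - Suc j) y \<partial>P (w j)) = q k * u ^ (j - k) * hit_weight C u (N - j) (w j)"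
        unfolding Nj using j by (simp add: stop_def Suc_diff_le)
      finally show ?thesis by (simp add: bound_def)
    qed
    have main: "V j w \<le> bound (stop (N - j) (w j)) j w" if "k < j" "j \<le> N" "w \<in> space paths" "w k \<in> C" for j w
      using that
    proof (induction "N - j" arbitrary: j w rule: less_induct)
      case (less j w)
      show ?case
      proof (cases "w j \<in> C \<or> j = N")
        case True
        have s: "stop (N - j) (w j) = 1" using True by (auto simp: stop_def)
        have "V j w \<le> exp (g j w + Mc * (\<Sum>l\<in>{j..<N}. q l))"
        proof (cases "j = N")
          case False
          with True show ?thesis
            unfolding V_def g_def using less.prems kN by (intro outer) auto
        qed (simp add: V_def g_def)
        also have "\<dots> \<le> exp (g j w + Mc * (\<Sum>l\<in>{Suc k..<N}. q l))"
          using less.prems Mc q by (auto intro!: mult_left_mono sum_mono2)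
        also have "\<dots> = E * exp (g k w) * exp (g j w - g k w)"
          by (simp add: E_def exp_add[symmetric])
        also have "\<dots> \<le> bound 1 j w"
          unfolding bound_def using E0 less.prems True inc[of w k j]
          by (intro mult_left_mono) (auto simp: g_def)
        finally show ?thesis by (simp add: s)
      next
        case False
        then have "j < N" using less.prems by auto
        then have "V j w \<le> bound (hit_weight C u (N - j) (w j)) j w"
          using less.prems by (intro step less.hyps) auto
        with False show ?thesis by (simp add: stop_def)
      qed
    qed
    have "V k w \<le> bound (hit_weight C u (N - k) (w k)) k w"
      using kN less.prems by (intro step main) auto
    \<comment> \<open>At \<open>j = k\<close> the linear term vanishes: the increment up to the
      stopped return time has mean zero.\<close>
    also have "\<dots> = E * exp (g k w) * (1 + q k * hit_weight C u (N - k) (w k))" by (simp add: bound_def)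
    also have "\<dots> \<le> E * exp (g k w) * (1 + q k * Mc)"
      using E0 q hw less.prems by (intro mult_left_mono add_left_mono) auto
    also have "\<dots> \<le> E * exp (g k w) * exp (q k * Mc)"
      using E0 by (intro mult_left_mono exp_ge_add_one_self) auto
    also have "\<dots> = exp (g k w + Mc * (\<Sum>l\<in>{k..<N}. q l))"
      using kN by (simp add: E_def exp_add[symmetric] sum.atLeast_Suc_lessThan algebra_simps)
    finally show ?thesis by (simp add: V_def g_def)
  qed
qed

end

section \<open>Exponential moment for small, then for arbitrary coefficients\<close>

context markov_kernel
begin

text \<open>The 8 is half of the 16 in the increment bound, by the 1/2 of the Taylor remainder. One
  factor \<open>1 / (1 - \<gamma>)\<close> stems from Cauchy-Schwarz, the other from summing the
  weight of a coordinate over all starting times before it.\<close>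

lemma exp_moment_small_coefficients:
  fixes c :: "nat \<Rightarrow> real"
  assumes C: "C \<in> sets M" and u: "1 < u" and f: "bounded_measurable paths f" and dep: "depends_on M 0 (Suc N) f"
    and hw: "\<And>m x. x \<in> C \<Longrightarrow> hit_weight C u m x \<le> Mc" and Mc: "0 \<le> Mc"
    and pi: "prob_space \<pi>" "sets \<pi> = sets M"
    and conv: "\<And>x m. x \<in> C \<Longrightarrow> dTV (kpow M P m x) \<pi> \<le> L * r ^ m" and L: "1 \<le> L"
    and r: "0 < r" "r \<le> \<gamma>" and \<gamma>: "\<gamma> < 1" "u powr (-1/4) \<le> \<gamma>"
    and bd: "\<And>v v'. v \<in> space paths \<Longrightarrow> v' \<in> space paths \<Longrightarrow>
      \<bar>f v - f v'\<bar> \<le> (\<Sum>i<Suc N. c i * (if v i \<noteq> v' i then 1 else 0))"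
    and c: "\<And>i. i \<le> N \<Longrightarrow> 0 \<le> c i" "\<And>i. i \<le> N \<Longrightarrow> c i \<le> (1 - \<gamma>)\<^sup>2 * ln u / (10 * L)"
    and w: "w \<in> space paths" "w 0 \<in> C"
  shows "cexp 0 N (\<lambda>w. exp (f w)) w \<le> exp (cexp 0 N f w + 8 * L\<^sup>2 * Mc / (1 - \<gamma>)\<^sup>2 * (\<Sum>i<Suc N. (c i)\<^sup>2))"
proof -
  define q where "q k = 8 * L\<^sup>2 / (1 - \<gamma>) * (\<Sum>i\<in>{k..<N}. (c (Suc i))\<^sup>2 * \<gamma> ^ (Suc i - k))" for k
  have \<gamma>0: "0 < \<gamma>" using r by simp
  have q0: "0 \<le> q k" for k
    unfolding q_def using \<gamma>0 \<gamma> by (intro mult_nonneg_nonneg divide_nonneg_nonneg sum_nonneg) auto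
  have "cexp 0 (N - 0) (\<lambda>w. exp (f w)) w \<le> exp (cexp 0 (N - 0) f w + Mc * (\<Sum>l\<in>{0..<N}. q l))"
  proof (rule cexp_exp_le[OF C _ f dep hw q0 Mc])
    fix k j w assume w: "w \<in> space paths" and kj: "k < j" "j \<le> N" and wC: "w k \<in> C" "j < N \<Longrightarrow> w j \<in> C"
    let ?D = "cexp j (N - j) f w - cexp k (N - k) f w"
    let ?d = "(\<Sum>i\<in>{k..<j}. c (Suc i)) + 4 * L * (\<Sum>i\<in>{j..<N}. c (Suc i) * r ^ (Suc i - j))"
    have "\<bar>?D\<bar> \<le> ?d"
      by (rule cexp_difference_bound[where C=C and \<pi>=\<pi>, OF w f dep bd c(1) pi conv])
        (use r \<gamma> L kj wC in auto)
    then have "exp ?D \<le> 1 + ?D + ?d\<^sup>2 * exp ?d / 2" by (rule exp_le_quadratic)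
    moreover have "?d\<^sup>2 * exp ?d \<le> 16 * L\<^sup>2 / (1 - \<gamma>) * (\<Sum>i\<in>{k..<N}. (c (Suc i))\<^sup>2 * \<gamma> ^ (Suc i - k)) * u ^ (j - k)"
      by (rule increment_exp_bound[OF _ _ r \<gamma> u L kj refl]) (use c in auto)
    moreover have "\<dots> = 2 * (q k * u ^ (j - k))" by (simp add: q_def)
    ultimately show "exp ?D \<le> 1 + ?D + q k * u ^ (j - k)" by linarith
  qed (use u w in auto)
  also have "Mc * (\<Sum>l\<in>{0..<N}. q l) \<le> 8 * L\<^sup>2 * Mc / (1 - \<gamma>)\<^sup>2 * (\<Sum>i<Suc N. (c i)\<^sup>2)"
  proof -
    let ?a = "\<lambda>l i. (c (Suc i))\<^sup>2 * \<gamma> ^ (Suc i - l)"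
    \<comment> \<open>Exchange of summations: coordinate \<open>Suc i\<close> is charged by every
      starting time \<open>l \<le> i\<close>.\<close>
    have "(\<Sum>l\<in>{0..<N}. \<Sum>i\<in>{l..<N}. ?a l i) = (\<Sum>l\<in>{0..<N}. \<Sum>i | i \<in> {0..<N} \<and> l \<le> i. ?a l i)"
      by (intro sum.cong) auto
    also have "\<dots> = (\<Sum>i\<in>{0..<N}. \<Sum>l | l \<in> {0..<N} \<and> l \<le> i. ?a l i)"
      by (rule sum.swap_restrict) auto
    also have "\<dots> = (\<Sum>i\<in>{0..<N}. (c (Suc i))\<^sup>2 * (\<Sum>l\<in>{0..i}. \<gamma> ^ (Suc i - l)))"
      unfolding sum_distrib_left by (intro sum.cong) auto
    also have "\<dots> \<le> (\<Sum>i\<in>{0..<N}. (c (Suc i))\<^sup>2 * (1 / (1 - \<gamma>)))"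
      by (intro sum_mono mult_left_mono geometric_sum_le' \<gamma>0 \<gamma>) auto
    also have "\<dots> = (\<Sum>i<N. (c (Suc i))\<^sup>2) / (1 - \<gamma>)"
      by (simp add: sum_divide_distrib atLeast0LessThan)
    also have "\<dots> \<le> (\<Sum>i<Suc N. (c i)\<^sup>2) / (1 - \<gamma>)"
      unfolding sum.lessThan_Suc_shift using \<gamma> by (intro divide_right_mono) auto
    finally have "(\<Sum>l\<in>{0..<N}. q l) \<le> 8 * L\<^sup>2 / (1 - \<gamma>) * ((\<Sum>i<Suc N. (c i)\<^sup>2) / (1 - \<gamma>))"
      unfolding q_def sum_distrib_left[symmetric] using \<gamma> by (intro mult_left_mono) auto
    then have "Mc * (\<Sum>l\<in>{0..<N}. q l) \<le> Mc * (8 * L\<^sup>2 / (1 - \<gamma>) * ((\<Sum>i<Suc N. (c i)\<^sup>2) / (1 - \<gamma>)))"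
      using Mc by (intro mult_left_mono)
    also have "\<dots> = 8 * L\<^sup>2 * Mc / (1 - \<gamma>)\<^sup>2 * (\<Sum>i<Suc N. (c i)\<^sup>2)"
      by (simp add: power2_eq_square)
    finally show ?thesis .
  qed
  finally show ?thesis by simp
qed

text \<open>Freezing alters the function and not the chain, so every hypothesis on \<open>P\<close>
  survives, and frozen coordinates get coefficient 0. The error \<open>A\<close> is paid twice, once
  in the exponential moment and once in the mean. The resulting \<open>2 / \<epsilon>\<close> is the
  first constant of the bound.\<close>

lemma exp_moment:
  fixes c :: "nat \<Rightarrow> real"
  assumes C: "C \<in> sets M" and u: "1 < u" and f: "bounded_measurable paths f" and dep: "depends_on M 0 (Suc N) f"
    and hw: "\<And>m x. x \<in> C \<Longrightarrow> hit_weight C u m x \<le> Mc" and Mc: "0 \<le> Mc"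
    and pi: "prob_space \<pi>" "sets \<pi> = sets M"
    and conv: "\<And>x m. x \<in> C \<Longrightarrow> dTV (kpow M P m x) \<pi> \<le> L * r ^ m" and L: "1 \<le> L"
    and r: "0 < r" "r \<le> \<gamma>" and \<gamma>: "\<gamma> < 1" "u powr (-1/4) \<le> \<gamma>"
    and bd: "\<And>v v'. v \<in> space paths \<Longrightarrow> v' \<in> space paths \<Longrightarrow>
      \<bar>f v - f v'\<bar> \<le> (\<Sum>i<Suc N. c i * (if v i \<noteq> v' i then 1 else 0))"
    and c: "\<And>i. i \<le> N \<Longrightarrow> 0 \<le> c i"
    and w: "w \<in> space paths" "w 0 \<in> C"
  shows "cexp 0 N (\<lambda>w. exp (f w)) w
    \<le> exp (cexp 0 N f w + (20 * L / ((1 - \<gamma>)\<^sup>2 * ln u) + 8 * L\<^sup>2 * Mc / (1 - \<gamma>)\<^sup>2) * (\<Sum>i<Suc N. (c i)\<^sup>2))"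
proof -
  define \<epsilon> where "\<epsilon> = (1 - \<gamma>)\<^sup>2 * ln u / (10 * L)"
  define c' where "c' i = (if c i > \<epsilon> then 0 else c i)" for i
  define A where "A = (\<Sum>i<Suc N. if c i > \<epsilon> then c i else 0)"
  define freeze where "freeze v = (\<lambda>i. if c i > \<epsilon> then w i else v i)" for v
  define f' where "f' v = f (freeze v)" for v
  let ?K = "8 * L\<^sup>2 * Mc / (1 - \<gamma>)\<^sup>2"
  have \<epsilon>0: "0 < \<epsilon>" unfolding \<epsilon>_def using \<gamma> u L by simp
  have fr: "freeze v \<in> space paths" if "v \<in> space paths" for v
    using that w by (auto simp: freeze_def space_PiM PiE_iff)
  have fr_m: "freeze \<in> paths \<rightarrow>\<^sub>M paths"
  proof (rule measurable_PiM_single')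
    show "(\<lambda>v. freeze v i) \<in> paths \<rightarrow>\<^sub>M M" for i
      using in_pathsD[OF w(1)] by (cases "c i > \<epsilon>") (simp_all add: freeze_def)
  qed (use fr in \<open>auto simp: space_PiM PiE_iff\<close>)
  have f': "bounded_measurable paths f'"
    unfolding f'_def by (rule bounded_measurable_compose[OF f fr_m])
  have close: "\<bar>f v - f' v\<bar> \<le> A" if "v \<in> space paths" for v
  proof -
    have "\<bar>f v - f' v\<bar> \<le> (\<Sum>i<Suc N. c i * (if v i \<noteq> freeze v i then 1 else 0))"
      unfolding f'_def by (intro bd fr that)
    also have "\<dots> \<le> A" unfolding A_def by (intro sum_mono) (use c in \<open>auto simp: freeze_def\<close>)
    finally show ?thesis .
  qed
  have small: "cexp 0 N (\<lambda>w. exp (f' w)) w \<le> exp (cexp 0 N f' w + ?K * (\<Sum>i<Suc N. (c' i)\<^sup>2))"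
  proof (rule exp_moment_small_coefficients[OF C u f' _ hw Mc pi conv L r \<gamma> _ _ _ w])
    show "depends_on M 0 (Suc N) f'"
      unfolding depends_on_def f'_def
      by (intro ballI impI depends_onD[OF dep] fr) (auto simp: freeze_def)
    show "\<bar>f' v - f' v'\<bar> \<le> (\<Sum>i<Suc N. c' i * (if v i \<noteq> v' i then 1 else 0))"
      if "v \<in> space paths" "v' \<in> space paths" for v v'
    proof -
      have "\<bar>f' v - f' v'\<bar> \<le> (\<Sum>i<Suc N. c i * (if freeze v i \<noteq> freeze v' i then 1 else 0))"
        unfolding f'_def by (intro bd fr that)
      also have "\<dots> = (\<Sum>i<Suc N. c' i * (if v i \<noteq> v' i then 1 else 0))"
        by (intro sum.cong) (auto simp: freeze_def c'_def)
      finally show ?thesis .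
    qed
    show "0 \<le> c' i" "c' i \<le> (1 - \<gamma>)\<^sup>2 * ln u / (10 * L)" if "i \<le> N" for i
      using c[OF that] \<epsilon>0 by (auto simp: c'_def \<epsilon>_def[symmetric])
  qed auto
  have "cexp 0 N (\<lambda>w. exp (f w)) w \<le> cexp 0 N (\<lambda>w. exp A * exp (f' w)) w"
  proof (rule cexp_mono[OF bounded_measurable_exp[OF f] _ w(1)])
    show "exp (f v) \<le> exp A * exp (f' v)" if "v \<in> space paths" for v
      using close[OF that] by (simp add: exp_add[symmetric])
  qed (intro bounded_measurable_mult bounded_measurable_const bounded_measurable_exp f')
  also have "\<dots> = exp A * cexp 0 N (\<lambda>w. exp (f' w)) w"
    by (rule cexp_cmult[OF bounded_measurable_exp[OF f'] w(1)])
  also have "\<dots> \<le> exp A * exp (cexp 0 N f' w + ?K * (\<Sum>i<Suc N. (c' i)\<^sup>2))"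
    using small by (intro mult_left_mono) auto
  also have "\<dots> = exp (cexp 0 N f' w + (A + ?K * (\<Sum>i<Suc N. (c' i)\<^sup>2)))" by (simp add: exp_add[symmetric])
  also have "\<dots> \<le> exp (cexp 0 N f w + (20 * L / ((1 - \<gamma>)\<^sup>2 * ln u) + ?K) * (\<Sum>i<Suc N. (c i)\<^sup>2))"
  proof -
    have "cexp 0 N f' w \<le> cexp 0 N (\<lambda>v. f v + A) w"
    proof (rule cexp_mono[OF f' _ w(1)])
      show "f' v \<le> f v + A" if "v \<in> space paths" for v using close[OF that] by linarith
    qed (intro bounded_measurable_add f bounded_measurable_const)
    also have "\<dots> = cexp 0 N f w + A"
      using w f by (simp add: cexp_plus cexp_const bounded_measurable_const)
    finally have 1: "cexp 0 N f' w \<le> cexp 0 N f w + A" .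
    have e: "20 * L / ((1 - \<gamma>)\<^sup>2 * ln u) = 2 / \<epsilon>" by (simp add: \<epsilon>_def)
    have K0: "0 \<le> ?K" using Mc by simp
    \<comment> \<open>Each index is either frozen or small and contributes to one of the two sums
      only; for a frozen one, \<open>c i > \<epsilon>\<close> trades \<open>2 * c i\<close> for
      \<open>2 / \<epsilon>\<close> times the square.\<close>
    have "2 * A + ?K * (\<Sum>i<Suc N. (c' i)\<^sup>2) = (\<Sum>i<Suc N. if c i > \<epsilon> then 2 * c i else ?K * (c i)\<^sup>2)"
      unfolding A_def c'_def sum_distrib_left sum.distrib[symmetric] by (intro sum.cong) auto
    also have "\<dots> \<le> (\<Sum>i<Suc N. (2 / \<epsilon> + ?K) * (c i)\<^sup>2)"
    proof (intro sum_mono)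
      fix i assume "i \<in> {..<Suc N}"
      then have ci: "0 \<le> c i" using c by auto
      have "2 * c i \<le> 2 / \<epsilon> * (c i)\<^sup>2" if "c i > \<epsilon>"
        using that ci \<epsilon>0 by (simp add: power2_eq_square field_simps mult_left_mono)
      moreover have "0 \<le> 2 / \<epsilon> * (c i)\<^sup>2" "0 \<le> ?K * (c i)\<^sup>2" 
        using \<epsilon>0 by (simp, intro mult_nonneg_nonneg K0 zero_le_power2)
      ultimately show "(if c i > \<epsilon> then 2 * c i else ?K * (c i)\<^sup>2) \<le> (2 / \<epsilon> + ?K) * (c i)\<^sup>2"
        unfolding distrib_right by (cases "c i > \<epsilon>") simp_all
    qed
    finally have "2 * A + ?K * (\<Sum>i<Suc N. (c' i)\<^sup>2) \<le> (20 * L / ((1 - \<gamma>)\<^sup>2 * ln u) + ?K) * (\<Sum>i<Suc N. (c i)\<^sup>2)"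
      unfolding e sum_distrib_left .
    then show ?thesis using 1 by simp
  qed
  finally show ?thesis .
qed

end

section \<open>The deviation inequality by Chernoff's method\<close>

theorem theorem1:
  fixes M :: "'a measure" and P :: "'a \<Rightarrow> 'a measure" and \<pi> :: "'a measure"
    and C :: "'a set" and u Mc r L :: real and n :: nat and c :: "nat \<Rightarrow> real"
    and f :: "(nat \<Rightarrow> 'a) \<Rightarrow> real"
  assumes kernel: "P \<in> M \<rightarrow>\<^sub>M prob_algebra M"
    and irr: "irreducible M P" and aper: "aperiodic M P"
    and inv: "invariant_prob M P \<pi>"
    and uniq: "\<And>\<pi>'. invariant_prob M P \<pi>' \<Longrightarrow> \<pi>' = \<pi>"
    and C_sets: "C \<in> sets M" and C_ne: "C \<noteq> {}"
    and u: "u > 1" and Mc: "Mc > 0"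
    and drift: "\<forall>x\<in>C. exp_hit M P x C u \<le> ennreal Mc"
    and r: "0 < r" "r < 1" and L: "L \<ge> 1"
    and conv: "\<forall>x\<in>C. \<forall>k. dTV (kpow M P k x) \<pi> \<le> L * r ^ k"
    and n: "n \<ge> 1"
    and c_nonneg: "\<forall>i<n. c i \<ge> 0"
    and f_meas: "f \<in> borel_measurable (PiM {..<n} (\<lambda>_. M))"
    and f_bd: "\<forall>x\<in>space (PiM {..<n} (\<lambda>_. M)). \<forall>y\<in>space (PiM {..<n} (\<lambda>_. M)).
                 \<bar>f x - f y\<bar> \<le> (\<Sum>i<n. c i * (if x i \<noteq> y i then 1 else 0))"
  shows "\<forall>x\<in>C. \<forall>t>0.
    measure (chain_law M P (return M x) n)
      {\<omega> \<in> space (PiM {..<n} (\<lambda>_. M)).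
         f \<omega> - integral\<^sup>L (chain_law M P (return M x) n) f > t}
    \<le> exp (- (((1 - max r (u powr (-1/4)))\<^sup>2 / (16 * L)) * inverse (5 / ln u + 4 * Mc * L))
             * t\<^sup>2 / (\<Sum>i<n. (c i)\<^sup>2))"
proof (intro ballI allI impI)
  fix x t assume xC: "x \<in> C" and t: "(0::real) < t"
  interpret markov_kernel M P by unfold_locales (rule kernel)
  obtain N where N: "n = Suc N" using n by (cases n) auto
  define \<gamma> where "\<gamma> = max r (u powr (-1/4))"
  define S where "S = (\<Sum>i<n. (c i)\<^sup>2)"
  define \<beta> where "\<beta> = ((1 - \<gamma>)\<^sup>2 / (16 * L)) * inverse (5 / ln u + 4 * Mc * L)"
  let ?K = "PiM {..<n} (\<lambda>_. M)"
  define Q where "Q = chain_law M P (return M x) n"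
  \<comment> \<open>Any path starting at \<open>x\<close> would serve; the constant one is at
    hand.\<close>
  define w where "w = (\<lambda>_::nat. x)"
  have xM: "x \<in> space M" using xC C_sets sets.sets_into_space by blast
  have w: "w \<in> space paths" "w 0 = x" using xM by (auto simp: w_def space_PiM)
  have "u powr (-1/4) < u powr 0" using u by (intro powr_less_mono) auto
  then have \<gamma>: "\<gamma> < 1" "r \<le> \<gamma>" "u powr (-1/4) \<le> \<gamma>" using r u by (auto simp: \<gamma>_def)
  have Q: "prob_space Q" "sets Q = sets ?K"
    using chain_law_prob[of "return M x" N] xM by (auto simp: Q_def N space_prob_algebra prob_space_return)
  interpret Q: prob_space Q by (rule Q)
  have spQ: "space Q = space ?K" using Q(2) by (rule sets_eq_imp_space_eq)
  have restr: "(\<lambda>v. restrict v {..<n}) \<in> paths \<rightarrow>\<^sub>M ?K"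
    by (rule measurable_restrict_subset) simp
  obtain v0 where v0: "v0 \<in> space ?K" using measurable_space[OF restr w(1)] by blast
  have f_bm: "bounded_measurable ?K f"
  proof (rule bounded_measurableI[OF f_meas, where B="\<bar>f v0\<bar> + (\<Sum>i<n. c i)"])
    fix v assume "v \<in> space ?K"
    then have "\<bar>f v - f v0\<bar> \<le> (\<Sum>i<n. c i * (if v i \<noteq> v0 i then 1 else 0))" using f_bd v0 by blast
    also have "\<dots> \<le> (\<Sum>i<n. c i)" by (intro sum_mono) (use c_nonneg in auto)
    finally show "\<bar>f v\<bar> \<le> \<bar>f v0\<bar> + (\<Sum>i<n. c i)" by linarith
  qed
  have hw: "hit_weight C u m y \<le> Mc" if "y \<in> C" for m y
  proof -
    have yM: "y \<in> space M" using that C_sets sets.sets_into_space by blast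
    have le: "exp_hit M P y C u \<le> ennreal Mc" using drift that by blast
    then have "exp_hit M P y C u < \<top>" by (rule le_less_trans) simp
    then have "ennreal (hit_weight C u m y) \<le> ennreal Mc"
      using hit_weight_le_exp_hit[OF C_sets _ yM, of u m] u le by (auto intro: order.trans)
    then show ?thesis using Mc by (simp add: ennreal_le_iff)
  qed
  have L0: "0 < L" using L by simp
  have D: "0 < 5 / ln u + 4 * Mc * L" using u Mc L0 by (intro add_pos_pos) auto
  have \<beta>0: "0 < \<beta>" unfolding \<beta>_def using D L0 \<gamma> by simp
  \<comment> \<open>\<open>1 / (4 * \<beta>)\<close> splits into \<open>20 * L\<close>, matching the
    freezing cost exactly, and \<open>16 * L\<^sup>2 * Mc\<close>, twice the excursion cost.\<close>
  have \<kappa>: "20 * L / ((1 - \<gamma>)\<^sup>2 * ln u) + 8 * L\<^sup>2 * Mc / (1 - \<gamma>)\<^sup>2 \<le> 1 / (4 * \<beta>)"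
  proof -
    have "1 / (4 * \<beta>) = 4 * L / (1 - \<gamma>)\<^sup>2 * (5 / ln u + 4 * Mc * L)"
      unfolding \<beta>_def using D by (simp add: divide_simps)
    also have "\<dots> = 20 * L / ((1 - \<gamma>)\<^sup>2 * ln u) + 16 * L\<^sup>2 * Mc / (1 - \<gamma>)\<^sup>2"
      by (simp add: distrib_left power2_eq_square[of L])
    finally have eq: "1 / (4 * \<beta>) = 20 * L / ((1 - \<gamma>)\<^sup>2 * ln u) + 16 * L\<^sup>2 * Mc / (1 - \<gamma>)\<^sup>2" .
    show ?thesis unfolding eq using Mc by (intro add_left_mono divide_right_mono mult_right_mono) auto
  qed
  have S0: "0 \<le> S" unfolding S_def by (intro sum_nonneg) simp
  \<comment> \<open>Applied to \<open>s * f\<close> with coefficients \<open>s * c i\<close>: the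
    set of frozen coordinates depends on \<open>s\<close>, the constant does not.\<close>
  have moment: "(\<integral>v. exp (s * f v) \<partial>Q) \<le> exp (s * integral\<^sup>L Q f + s\<^sup>2 * S / (4 * \<beta>))" if s: "0 \<le> s" for s
  proof -
    define F where "F v = s * f (restrict v {..<n})" for v
    have f_r: "bounded_measurable paths (\<lambda>v. f (restrict v {..<n}))"
      by (rule bounded_measurable_compose[OF f_bm restr])
    have F_bm: "bounded_measurable paths F"
      unfolding F_def by (intro bounded_measurable_mult bounded_measurable_const f_r)
    have "(\<integral>v. exp (s * f v) \<partial>Q) = cexp 0 N (\<lambda>v. exp (F v)) w"
      unfolding Q_def N F_def
      by (rule integral_chain_law[OF xM w bounded_measurable_exp[OF bounded_measurable_mult[OF bounded_measurable_const f_bm[unfolded N]]]])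
    also have "\<dots> \<le> exp (cexp 0 N F w + (20 * L / ((1 - \<gamma>)\<^sup>2 * ln u) + 8 * L\<^sup>2 * Mc / (1 - \<gamma>)\<^sup>2) * (\<Sum>i<Suc N. (s * c i)\<^sup>2))"
    proof (rule exp_moment[OF C_sets u F_bm _ hw _ _ _ _ L r(1) \<gamma>(2,1,3)])
      show "depends_on M 0 (Suc N) F"
        unfolding depends_on_def F_def N by (auto intro!: arg_cong[where f=f])
      show "prob_space \<pi>" "sets \<pi> = sets M" using inv by (auto simp: invariant_prob_def)
      show "\<bar>F v - F v'\<bar> \<le> (\<Sum>i<Suc N. s * c i * (if v i \<noteq> v' i then 1 else 0))"
        if "v \<in> space paths" "v' \<in> space paths" for v v'
      proof -
        have "\<bar>f (restrict v {..<n}) - f (restrict v' {..<n})\<bar>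
            \<le> (\<Sum>i<n. c i * (if restrict v {..<n} i \<noteq> restrict v' {..<n} i then 1 else 0))"
          using measurable_space[OF restr] that f_bd by blast
        also have "\<dots> = (\<Sum>i<n. c i * (if v i \<noteq> v' i then 1 else 0))" by (intro sum.cong) auto
        finally have "s * \<bar>f (restrict v {..<n}) - f (restrict v' {..<n})\<bar> \<le> s * (\<Sum>i<n. c i * (if v i \<noteq> v' i then 1 else 0))"
          using s by (rule mult_left_mono)
        moreover have "\<bar>F v - F v'\<bar> = s * \<bar>f (restrict v {..<n}) - f (restrict v' {..<n})\<bar>"
          unfolding F_def right_diff_distrib[symmetric] abs_mult using s by simp
        ultimately show ?thesis unfolding N sum_distrib_left by (simp only: mult.assoc)
      qed
    qed (use Mc conv c_nonneg s xC w in \<open>auto simp: N\<close>)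
    also have "cexp 0 N F w = s * integral\<^sup>L Q f"
      unfolding F_def cexp_cmult[OF f_r w(1)] unfolding Q_def N
      by (rule arg_cong[OF integral_chain_law[OF xM w f_bm[unfolded N], symmetric]])
    also have "(\<Sum>i<Suc N. (s * c i)\<^sup>2) = s\<^sup>2 * S"
      unfolding S_def N power_mult_distrib sum_distrib_left ..
    also have "exp (s * integral\<^sup>L Q f + (20 * L / ((1 - \<gamma>)\<^sup>2 * ln u) + 8 * L\<^sup>2 * Mc / (1 - \<gamma>)\<^sup>2) * (s\<^sup>2 * S))
      \<le> exp (s * integral\<^sup>L Q f + 1 / (4 * \<beta>) * (s\<^sup>2 * S))"
      unfolding exp_le_cancel_iff using S0 by (intro add_left_mono mult_right_mono \<kappa>) auto
    finally show ?thesis by simp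
  qed
  have "measure Q {v \<in> space ?K. f v - integral\<^sup>L Q f > t} \<le> exp (- \<beta> * t\<^sup>2 / S)"
  \<comment> \<open>Division by zero is 0 in HOL, so for \<open>S = 0\<close> the right-hand side is
    1 and the claim is trivial.\<close>
  proof (cases "S = 0")
    case True
    then show ?thesis by simp
  next
    case False
    with S0 have Sp: "0 < S" by simp
    \<comment> \<open>The minimiser of \<open>s\<^sup>2 * S / (4 * \<beta>) - s * t\<close>.\<close>
    define s where "s = 2 * \<beta> * t / S"
    have s: "0 < s" unfolding s_def using \<beta>0 t Sp by simp
    define m where "m = integral\<^sup>L Q f"
    have e_bm: "bounded_measurable ?K (\<lambda>v. exp (s * f v))"
      by (intro bounded_measurable_exp bounded_measurable_mult bounded_measurable_const f_bm)
    have meas: "{v \<in> space Q. exp (s * (m + t)) \<le> exp (s * f v)} \<in> sets Q"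
      using e_bm unfolding bounded_measurable_def
      by (intro borel_measurable_le) (simp_all add: measurable_cong_sets[OF Q(2) refl])
    have "measure Q {v \<in> space ?K. f v - m > t} \<le> measure Q {v \<in> space Q. exp (s * (m + t)) \<le> exp (s * f v)}"
      using s by (intro Q.finite_measure_mono meas) (auto simp: spQ)
    also have "\<dots> \<le> (\<integral>v. exp (s * f v) \<partial>Q) / exp (s * (m + t))"
      by (rule integral_Markov_inequality_measure[where A="{}"])
         (auto intro: bounded_measurable_integrable[OF e_bm Q(2) Q.finite_measure_axioms])
    also have "\<dots> \<le> exp (s * m + s\<^sup>2 * S / (4 * \<beta>)) / exp (s * (m + t))"
      using moment[of s] s by (intro divide_right_mono) (auto simp: m_def)
    also have "\<dots> = exp (s\<^sup>2 * S / (4 * \<beta>) - s * t)"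
      by (simp add: exp_diff[symmetric] algebra_simps)
    also have "s\<^sup>2 * S / (4 * \<beta>) - s * t = - \<beta> * t\<^sup>2 / S"
      unfolding s_def using Sp \<beta>0 by (simp add: field_simps power2_eq_square)
    finally show ?thesis by (simp add: m_def)
  qed
  then show "measure (chain_law M P (return M x) n)
      {\<omega> \<in> space (PiM {..<n} (\<lambda>_. M)).
         f \<omega> - integral\<^sup>L (chain_law M P (return M x) n) f > t}
    \<le> exp (- (((1 - max r (u powr (-1/4)))\<^sup>2 / (16 * L)) * inverse (5 / ln u + 4 * Mc * L))
             * t\<^sup>2 / (\<Sum>i<n. (c i)\<^sup>2))"
    unfolding \<beta>_def \<gamma>_def S_def Q_def .
qed

end
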